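(* One has $$\mathrm{Quot}^d_{\mathcal F^r/\mathbb P^1/k}=\bigcup_{i_1\ge\cdots\ge i_s>0,\ \sum i_m=d}\mathbb Q^\ast_{[i_1,\dots,i_s]}.$$
   Context: $k$ is an algebraically closed field of any characteristic; $r\ge 2$ and $d\ge 1$ are fixed integers. For a $k$-algebra $A$ put $S_A=A[x,y]$, $\mathbb P^1_A=\mathrm{Proj}(S_A)$, $F_A^r=\bigoplus^rS_A$ with standard basis $e_1,\dots,e_r$, $\mathcal F^r=\bigoplus^r\mathcal O_{\mathbb P^1}$. $\mathrm{Quot}^d_{\mathcal F^r/\mathbb P^1/k}$ is the Quot scheme of flat quotients of $\mathcal F^r$ with constant Hilbert polynomial $d$; an $A$-point is a saturated graded quotient $F_A^r/V$ whose components of degree $\ge d$ are locally free of rank $d$ over $A$, and it is identified with its degree $d$ component $M=(F_A^r/V)_d$, a rank $d$ locally free quotient of $\bigoplus^rS_{A,d}$. For integers $i_1\ge\dots\ge i_s>0$ with $s\le r$ and $\sum_m i_m=d$, $\mathbb Q_{[i_1,\dots,i_s]}$ is the open subscheme of $\mathrm{Quot}^d_{\mathcal F^r/\mathbb P^1/k}$ whose $A$-points are the $M$ for which the images of the elements $x^{d-j}y^je_m$ ($1\le m\le s$, $0\le j\le i_m-1$) form an $A$-basis of $M$ (equivalently, the corresponding Plücker coordinate is invertible). $\mathbb Q^\ast_{[i_1,\dots,i_s]}$ is the union of all translates of $\mathbb Q_{[i_1,\dots,i_s]}$ under linear changes of the variables $x,y$ by matrices in $\mathrm{GL}_2(k)$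 and of the basis $e_1,\dots,e_r$ by matrices in $\mathrm{GL}_r(k)$. *)

theory Defs
  imports
    "HOL-Computational_Algebra.Computational_Algebra"
    "HOL-Library.Function_Algebras"
    "Jordan_Normal_Form.Matrix"
begin

text \<open>
  Schemes over \<open>k\<close> are treated through their functors of points. A \<open>k\<close>-algebra is a commutative
  ring type \<open>'a\<close> with a ring homomorphism \<open>\<phi> :: 'k \<Rightarrow> 'a\<close>; it is an arbitrary one, since the type
  is arbitrary. An open subfunctor has to be evaluated on \<open>A\<close> and also on the localizations
  \<open>A\<^sub>f\<close>, in order to form unions of open subschemes.
\<close>

section \<open>Localizations and bases\<close>

text \<open>
  For a module given as a subquotient \<open>X / V\<close> (\<open>V\<close> only matters through its intersection with \<open>X\<close>),
  the pair \<open>(m, p)\<close> stands for the fraction \<open>m / f\<^sup>p\<close> in the localization \<open>(X / V)\<^sub>f\<close>, and \<open>frac_eq\<close> is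
  equality of fractions. The ring \<open>A\<^sub>f\<close> itself is the case of scalar multiplication \<open>(*)\<close> and
  \<open>V = {0}\<close>.
\<close>

definition frac_eq ::
  "('a::comm_ring_1 \<Rightarrow> 'm::ab_group_add \<Rightarrow> 'm) \<Rightarrow> 'a \<Rightarrow> 'm set \<Rightarrow> 'm \<times> nat \<Rightarrow> 'm \<times> nat \<Rightarrow> bool"
  where
  "frac_eq scale f V u w \<longleftrightarrow>
     (\<exists>N. scale (f ^ N) (scale (f ^ snd w) (fst u) - scale (f ^ snd u) (fst w)) \<in> V)"

text \<open>
  The images of \<open>b i\<close>, \<open>i \<in> I\<close>, form a basis of the \<open>A\<^sub>f\<close>-module \<open>(X / V)\<^sub>f\<close>. Finitely many
  coefficients in \<open>A\<^sub>f\<close> are written with a common denominator \<open>f\<^sup>q\<close>.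
\<close>

definition basis_over ::
  "('a::comm_ring_1 \<Rightarrow> 'm::ab_group_add \<Rightarrow> 'm) \<Rightarrow> 'a \<Rightarrow> 'm set \<Rightarrow> 'm set \<Rightarrow> ('i \<Rightarrow> 'm) \<Rightarrow> 'i set \<Rightarrow> bool"
  where
  "basis_over scale f X V b I \<longleftrightarrow>
     finite I \<and> b ` I \<subseteq> X \<and>
     (\<forall>m\<in>X. \<forall>p. \<exists>c q. frac_eq scale f V (m, p) (\<Sum>i\<in>I. scale (c i) (b i), q)) \<and>
     (\<forall>c q. frac_eq scale f V (\<Sum>i\<in>I. scale (c i) (b i), q) (0, 0) \<longrightarrow>
        (\<forall>i\<in>I. frac_eq (*) f {0} (c i, q) (0, 0)))"

text \<open>Over \<open>A = A\<^sub>1\<close> this is the usual notion of a basis.\<close>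

lemma basis_over_1:
  fixes scale :: "'a::comm_ring_1 \<Rightarrow> 'm::ab_group_add \<Rightarrow> 'm"
  assumes "\<And>m. scale 1 m = m"
  shows "basis_over scale 1 X V b I \<longleftrightarrow>
     finite I \<and> b ` I \<subseteq> X \<and>
     (\<forall>m\<in>X. \<exists>c. m - (\<Sum>i\<in>I. scale (c i) (b i)) \<in> V) \<and>
     (\<forall>c. (\<Sum>i\<in>I. scale (c i) (b i)) \<in> V \<longrightarrow> (\<forall>i\<in>I. c i = 0))"
  unfolding basis_over_def frac_eq_def by (simp add: assms)

text \<open>
  Local freeness: there are elements generating the unit ideal such that each localization is free of
  rank \<open>d\<close>. A basis of \<open>(X / V)\<^sub>g\<close> may be taken to consist of images of elements of \<open>X\<close>, because
  \<open>g\<close> is a unit in \<open>A\<^sub>g\<close>.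
\<close>

definition locally_free ::
  "('a::comm_ring_1 \<Rightarrow> 'm::ab_group_add \<Rightarrow> 'm) \<Rightarrow> nat \<Rightarrow> 'm set \<Rightarrow> 'm set \<Rightarrow> bool"
  where
  "locally_free scale d X V \<longleftrightarrow>
     (\<exists>G c. finite G \<and> (\<Sum>g\<in>G. c g * g) = 1 \<and>
        (\<forall>g\<in>G. \<exists>b. basis_over scale g X V b {..<d}))"


section \<open>The graded module \<open>F\<^sub>A\<^sup>r\<close>\<close>

text \<open>
  \<open>S\<^sub>A = A[x,y]\<close> is the type \<open>'a poly poly\<close>: \<open>coeff (coeff p j) i\<close> is the coefficient of
  \<open>x\<^sup>i y\<^sup>j\<close>.
\<close>

abbreviation const :: "'a::comm_ring_1 \<Rightarrow> 'a poly poly" where "const a \<equiv> [:[:a:]:]"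
abbreviation X_var :: "'a::comm_ring_1 poly poly" where "X_var \<equiv> [:[:0, 1:]:]"
abbreviation Y_var :: "'a::comm_ring_1 poly poly" where "Y_var \<equiv> [:0, 1:]"

definition hom_part :: "nat \<Rightarrow> 'a::comm_ring_1 poly poly \<Rightarrow> 'a poly poly" where
  "hom_part n p = (\<Sum>j\<le>n. const (coeff (coeff p j) (n - j)) * X_var ^ (n - j) * Y_var ^ j)"

text \<open>
  Elements of \<open>F\<^sub>A\<^sup>r\<close> are functions on \<open>\<nat>\<close> supported on \<open>{..<r}\<close>. Thus the basis vectors
  \<open>e\<^sub>1, \<dots>, e\<^sub>r\<close> are indexed here by \<open>0, \<dots>, r - 1\<close>.
\<close>

type_synonym 'a fvec = "nat \<Rightarrow> 'a poly poly"

definition F_mod :: "nat \<Rightarrow> 'a::comm_ring_1 fvec set" where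
  "F_mod r = {v. \<forall>m\<ge>r. v m = 0}"

definition smul :: "'a::comm_ring_1 poly poly \<Rightarrow> 'a fvec \<Rightarrow> 'a fvec" where
  "smul p v = (\<lambda>m. p * v m)"

definition ascale :: "'a::comm_ring_1 \<Rightarrow> 'a fvec \<Rightarrow> 'a fvec" where
  "ascale a v = smul (const a) v"

definition hcomp :: "nat \<Rightarrow> 'a::comm_ring_1 fvec \<Rightarrow> 'a fvec" where
  "hcomp n v = (\<lambda>m. hom_part n (v m))"

definition F_deg :: "nat \<Rightarrow> nat \<Rightarrow> 'a::comm_ring_1 fvec set" where
  "F_deg r n = {v \<in> F_mod r. hcomp n v = v}"

lemma module_smul: "Modules.module (smul :: 'a::comm_ring_1 poly poly \<Rightarrow> _)"
  by unfold_locales (auto simp: smul_def fun_eq_iff algebra_simps)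

definition graded_submodule :: "nat \<Rightarrow> 'a::comm_ring_1 fvec set \<Rightarrow> bool" where
  "graded_submodule r V \<longleftrightarrow>
     V \<subseteq> F_mod r \<and> Modules.module.subspace smul V \<and> (\<forall>v\<in>V. \<forall>n. hcomp n v \<in> V)"

text \<open>Saturation with respect to the irrelevant ideal \<open>(x, y)\<close>, whose \<open>N\<close>-th power is generated by
  the forms of degree \<open>N\<close>.\<close>

definition saturated :: "nat \<Rightarrow> 'a::comm_ring_1 fvec set \<Rightarrow> bool" where
  "saturated r V \<longleftrightarrow>
     (\<forall>v\<in>F_mod r. (\<exists>N. \<forall>p. hom_part N p = p \<longrightarrow> smul p v \<in> V) \<longrightarrow> v \<in> V)"


section \<open>The Quot functor and its open subfunctors\<close>

text \<open>The \<open>A\<close>-points of the Quot scheme; the quotient \<open>F\<^sub>A\<^sup>r / V\<close> is represented by \<open>V\<close>.\<close>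

definition Quot_points :: "nat \<Rightarrow> nat \<Rightarrow> 'a::comm_ring_1 fvec set set" where
  "Quot_points r d =
     {V. graded_submodule r V \<and> saturated r V \<and>
         (\<forall>n\<ge>d. locally_free ascale d (F_deg r n) V)}"

text \<open>
  An open subfunctor \<open>U\<close> of Quot is represented by the function that sends \<open>f\<close> to the set of those
  \<open>A\<close>-points of Quot whose restriction to \<open>A\<^sub>f\<close> belongs to \<open>U(A\<^sub>f)\<close>. In particular \<open>U 1\<close> is \<open>U(A)\<close>.

  In a union of open subschemes lie exactly those points that belong locally to one of them: the
  restriction of \<open>V\<close> to \<open>A\<^sub>f\<close> is in the union iff \<open>Spec A\<^sub>f\<close> is covered by finitely many basic open sets
  \<open>Spec A\<^bsub>fg\<^esub>\<close>, that is, the elements \<open>g\<close> generate the unit ideal of \<open>A\<^sub>f\<close>, over each of which \<open>V\<close> is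
  in some member of the family.
\<close>

definition open_union ::
  "'v set \<Rightarrow> ('a::comm_ring_1 \<Rightarrow> 'v set) set \<Rightarrow> 'a \<Rightarrow> 'v set"
  where
  "open_union P \<U> f =
     {V \<in> P. \<exists>G c n. finite G \<and> (\<Sum>g\<in>G. c g * g) = f ^ n \<and> (\<forall>g\<in>G. \<exists>U\<in>\<U>. V \<in> U (f * g))}"

text \<open>The lists \<open>[i\<^sub>1, \<dots>, i\<^sub>s]\<close> with \<open>i\<^sub>1 \<ge> \<dots> \<ge> i\<^sub>s > 0\<close>, \<open>s \<le> r\<close> and sum \<open>d\<close>.\<close>

definition partitions :: "nat \<Rightarrow> nat \<Rightarrow> nat list set" where
  "partitions r d =
     {is. sorted_wrt (\<ge>) is \<and> (\<forall>i\<in>set is. i > 0) \<and> length is \<le> r \<and> sum_list is = d}"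

text \<open>\<open>mon_elt d (m, j)\<close> is \<open>x\<^sup>d\<^sup>-\<^sup>j y\<^sup>j\<close> times the basis vector with index \<open>m\<close>.\<close>

definition mon_elt :: "nat \<Rightarrow> nat \<times> nat \<Rightarrow> 'a::comm_ring_1 fvec" where
  "mon_elt d = (\<lambda>(m, j). (\<lambda>l. if l = m then X_var ^ (d - j) * Y_var ^ j else 0))"

definition Q_open :: "nat \<Rightarrow> nat \<Rightarrow> nat list \<Rightarrow> 'a::comm_ring_1 \<Rightarrow> 'a fvec set set" where
  "Q_open r d is f =
     {V \<in> Quot_points r d.
        basis_over ascale f (F_deg r d) V (mon_elt d) (SIGMA m:{..<length is}. {..<is ! m})}"


section \<open>Translates\<close>

text \<open>Linear change of variables \<open>x \<mapsto> g\<^sub>0\<^sub>0 x + g\<^sub>0\<^sub>1 y\<close>, \<open>y \<mapsto> g\<^sub>1\<^sub>0 x + g\<^sub>1\<^sub>1 y\<close> in \<open>A[x,y]\<close>.\<close>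

definition change_vars ::
  "('k \<Rightarrow> 'a::comm_ring_1) \<Rightarrow> 'k mat \<Rightarrow> 'a poly poly \<Rightarrow> 'a poly poly"
  where
  "change_vars \<phi> g p =
     (let l = (\<lambda>i. const (\<phi> (g $$ (i, 0))) * X_var + const (\<phi> (g $$ (i, 1))) * Y_var)
      in poly (map_poly (\<lambda>q. poly (map_poly const q) (l 0)) p) (l 1))"

text \<open>
  The change of variables by \<open>g\<close> combined with the change of basis sending the basis vector with
  index \<open>j\<close> to the vector given by the \<open>j\<close>-th column of \<open>h\<close>.
\<close>

definition gl_act ::
  "('k \<Rightarrow> 'a::comm_ring_1) \<Rightarrow> nat \<Rightarrow> 'k mat \<Rightarrow> 'k mat \<Rightarrow> 'a fvec \<Rightarrow> 'a fvec"
  where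
  "gl_act \<phi> r g h v =
     (\<lambda>i. if i < r then \<Sum>j<r. const (\<phi> (h $$ (i, j))) * change_vars \<phi> g (v j) else 0)"

definition GL :: "nat \<Rightarrow> 'k::field mat set" where
  "GL n = {g \<in> carrier_mat n n. invertible_mat g}"

definition translate ::
  "('k \<Rightarrow> 'a::comm_ring_1) \<Rightarrow> nat \<Rightarrow> 'k mat \<Rightarrow> 'k mat \<Rightarrow> ('a \<Rightarrow> 'a fvec set set) \<Rightarrow> 'a \<Rightarrow> 'a fvec set set"
  where
  "translate \<phi> r g h U f = (\<lambda>V. gl_act \<phi> r g h ` V) ` U f"

definition Q_star ::
  "('k::field \<Rightarrow> 'a::comm_ring_1) \<Rightarrow> nat \<Rightarrow> nat \<Rightarrow> nat list \<Rightarrow> 'a \<Rightarrow> 'a fvec set set"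
  where
  "Q_star \<phi> r d is =
     open_union (Quot_points r d) {translate \<phi> r g h (Q_open r d is) | g h. g \<in> GL 2 \<and> h \<in> GL r}"

end

theory Submission
  imports Defs "Jordan_Normal_Form.Char_Poly"
begin

text \<open>
  Let \<open>V\<close> be an \<open>A\<close>-point of the Quot scheme. The \<open>f \<in> A\<close> such that \<open>V\<close> lies over \<open>A\<^sub>f\<close> in a
  translate of some \<open>\<Q>\<^bsub>[i\<^sub>1,\<dots>,i\<^sub>s]\<^esub>\<close> have to generate the unit ideal. If they did not, they would all
  lie in a maximal ideal \<open>\<mm>\<close>, so it suffices to find one such \<open>f\<close> outside a given \<open>\<mm>\<close>.

  Let \<open>M\<^sub>n\<close> be the fibre at \<open>\<mm>\<close> of the degree \<open>n\<close> component of \<open>F\<^sub>A\<^sup>r / V\<close>, a vector space over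
  \<open>A/\<mm>\<close> that has dimension \<open>d\<close> for all \<open>n \<ge> d\<close>. Some form \<open>l = x + c y\<close> with \<open>c \<in> k\<close> acts
  injectively from \<open>M\<^sub>d\<close> to \<open>M\<^bsub>d+1\<^esub>\<close> (\<open>exists_injective_linear_form\<close>). Indeed, for equal dimensions
  injective means surjective. If \<open>l\<close> is not surjective, the quotient \<open>M\<^bsub>d+1\<^esub> / l M\<^sub>d\<close> is nonzero, and
  the class of \<open>q e\<^sub>m\<close> in it depends only on the value of the form \<open>q\<close> at the zero of \<open>l\<close>. If \<open>d + 1\<close>
  different forms \<open>l\<close> failed, the product of all the others times \<open>y\<close> and a suitable \<open>e\<^sub>m\<close> would be
  nonzero in the quotient belonging to \<open>l\<close> and zero in the quotients belonging to the others. This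
  gives \<open>d + 1\<close> independent elements of \<open>M\<^bsub>d+1\<^esub>\<close>, a contradiction. There are enough values of \<open>c\<close>
  because an algebraically closed field is infinite.

  Put \<open>u\<^sub>m\<^sub>j = l\<^sup>d\<^sup>-\<^sup>j y\<^sup>j e\<^sub>m\<close>. Since \<open>l\<close> may be cancelled, a linear relation among those \<open>u\<^sub>m\<^sub>j\<close> with
  \<open>j < d\<close> remains a relation when every \<open>j\<close> is raised by one (\<open>shift\<close>): the operator \<open>y / l\<close>
  is well defined. Now adjoin the vectors \<open>e\<^sub>m\<close> one at a time. If \<open>i\<close> is the least exponent
  for which \<open>u\<^sub>m\<^sub>i\<close> depends on the elements chosen before and on \<open>u\<^sub>m\<^sub>j\<close> with \<open>j < i\<close>, then all \<open>u\<^sub>m\<^sub>j\<close>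
  depend on the former and the \<open>u\<^sub>m\<^sub>j\<close> with \<open>j < i\<close>, and these are independent. Such an \<open>i\<close> can
  only decrease when more elements have been chosen before; therefore always taking an \<open>e\<^sub>m\<close> for which it is
  largest yields \<open>i\<^sub>1 \<ge> i\<^sub>2 \<ge> \<dots>\<close> (\<open>greedy\<close>). The resulting elements form a basis of \<open>M\<^sub>d\<close>, so a shear of
  the variables and a permutation of the basis vectors suffice as changes of coordinates.

  Finally a basis of the fibre is a basis over some \<open>A\<^sub>f\<close> with \<open>f \<notin> \<mm>\<close> (\<open>free_at_lift\<close>), by Cramer's
  rule.
\<close>

section \<open>Closure operators with the exchange property\<close>

text \<open>
  The field \<open>A/\<mm>\<close> varies with the term \<open>\<mm>\<close> and is therefore not a type. All linear algebra over it
  is done on representatives, with the closure operator ``span modulo \<open>\<mm>\<close>''; exchange is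
  what remains of division by nonzero scalars, and it is enough for a theory of dimension.
\<close>
locale exchange_closure =
  fixes cl :: "'m set \<Rightarrow> 'm set"
  assumes subset_cl: "B \<subseteq> cl B"
    and cl_least: "A \<subseteq> cl B \<Longrightarrow> cl A \<subseteq> cl B"
    and exchange: "v \<notin> cl B \<Longrightarrow> v \<in> cl (insert w B) \<Longrightarrow> w \<in> cl (insert v B)"
begin

lemma cl_mono: "A \<subseteq> B \<Longrightarrow> cl A \<subseteq> cl B"
  using subset_cl[of B] by (intro cl_least) blast

definition indep :: "'m set \<Rightarrow> bool" where
  "indep S \<longleftrightarrow> (\<forall>v\<in>S. v \<notin> cl (S - {v}))"

lemma indep_subset: "indep S \<Longrightarrow> T \<subseteq> S \<Longrightarrow> indep T"
  unfolding indep_def using cl_mono[of "T - {v}" "S - {v}" for v] by blast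

lemma indep_insert:
  assumes "indep S" "v \<notin> cl S"
  shows "indep (insert v S)"
proof -
  have vS: "v \<notin> S" using assms(2) subset_cl by blast
  have "w \<notin> cl (insert v S - {w})" if "w \<in> S" for w
  proof
    assume "w \<in> cl (insert v S - {w})"
    then have w: "w \<in> cl (insert v (S - {w}))"
      using that vS by (metis insert_Diff_if singletonD)
    have "w \<notin> cl (S - {w})" using assms(1) that by (simp add: indep_def)
    from exchange[OF this w] have "v \<in> cl (insert w (S - {w}))" .
    then show False using assms(2) that by (simp add: insert_absorb)
  qed
  moreover have "insert v S - {v} = S" using vS by auto
  ultimately show ?thesis unfolding indep_def using assms(2) by auto
qed

lemma indep_extend:
  assumes "finite B" "indep B" "\<And>i. i < n \<Longrightarrow> a i \<notin> cl (B \<union> a ` {..<i})"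
  shows "indep (B \<union> a ` {..<n}) \<and> card (B \<union> a ` {..<n}) = card B + n"
  using assms(3)
proof (induction n)
  case 0
  then show ?case using assms(2) by simp
next
  case (Suc n)
  let ?B = "B \<union> a ` {..<n}"
  have IH: "indep ?B" "card ?B = card B + n" using Suc by simp_all
  have a: "a n \<notin> cl ?B" using Suc.prems by simp
  have "a n \<notin> ?B" using a subsetD[OF subset_cl] by metis
  moreover have "finite ?B" using assms(1) by simp
  ultimately have "card (insert (a n) ?B) = card B + Suc n" using IH(2) by simp
  moreover have "indep (insert (a n) ?B)" using IH(1) a by (rule indep_insert)
  moreover have "B \<union> a ` {..<Suc n} = insert (a n) ?B" by (auto simp: lessThan_Suc)
  ultimately show ?case by simp
qed

text \<open>
  When \<open>S\<close> grows by \<open>s\<close>, the element of \<open>U\<close> to be dropped is any element of a smallest \<open>U' \<subseteq> U\<close> with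
  \<open>s\<close> in the closure of \<open>S \<union> U'\<close>; such a \<open>U'\<close> is nonempty because \<open>S \<union> {s}\<close> is independent.
\<close>
lemma Steinitz:
  assumes "finite S" "indep S" "finite T" "S \<subseteq> cl T"
  shows "\<exists>U\<subseteq>T. card U + card S = card T \<and> T \<subseteq> cl (S \<union> U)"
  using assms
proof (induction S rule: finite_induct)
  case empty
  then show ?case using subset_cl by (intro exI[of _ T]) auto
next
  case (insert s S)
  have "indep S" using insert.prems(1) by (rule indep_subset) auto
  then obtain U where U: "U \<subseteq> T" "card U + card S = card T" "T \<subseteq> cl (S \<union> U)"
    using insert by auto
  have finU: "finite U" using U(1) insert.prems(2) finite_subset by blast
  have sS: "s \<notin> cl S"
    using insert.prems(1) insert.hyps(2) unfolding indep_def by auto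
  have "s \<in> cl (S \<union> U)"
    using insert.prems(3) cl_least[OF U(3)] by blast
  then have "\<exists>U'. U' \<subseteq> U \<and> s \<in> cl (S \<union> U')" by blast
  then obtain U' where U': "U' \<subseteq> U" "s \<in> cl (S \<union> U')"
    and min: "\<And>U''. U'' \<subseteq> U \<Longrightarrow> s \<in> cl (S \<union> U'') \<Longrightarrow> card U' \<le> card U''"
    using ex_has_least_nat[of "\<lambda>U'. U' \<subseteq> U \<and> s \<in> cl (S \<union> U')" _ card] by metis
  have finU': "finite U'" using U'(1) finU finite_subset by blast
  obtain u where u: "u \<in> U'" using sS U'(2) by (cases "U' = {}") auto
  have "s \<notin> cl (S \<union> (U' - {u}))"
  proof
    assume "s \<in> cl (S \<union> (U' - {u}))"
    then have "card U' \<le> card (U' - {u})" using min U'(1) by blast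
    then show False using u finU' by (metis card_Diff1_less not_less)
  qed
  moreover have "insert u (S \<union> (U' - {u})) = S \<union> U'" using u by auto
  ultimately have "u \<in> cl (insert s (S \<union> (U' - {u})))"
    using exchange U'(2) by metis
  moreover have "insert s (S \<union> (U' - {u})) \<subseteq> insert s S \<union> (U - {u})" using U'(1) by auto
  ultimately have ucl: "u \<in> cl (insert s S \<union> (U - {u}))" using cl_mono by blast
  have "S \<union> U \<subseteq> insert u (insert s S \<union> (U - {u}))" by auto
  also have "\<dots> \<subseteq> cl (insert s S \<union> (U - {u}))" using ucl subset_cl by auto
  finally have "T \<subseteq> cl (insert s S \<union> (U - {u}))" using U(3) cl_least by blast
  moreover have "card (U - {u}) + card (insert s S) = card T"
  proof -
    have "Suc (card (U - {u})) = card U" using u U'(1) finU by (intro card_Suc_Diff1) auto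
    then show ?thesis using U(2) insert.hyps by simp
  qed
  ultimately show ?case using U(1) by (intro exI[of _ "U - {u}"]) auto
qed

lemma card_indep_le:
  assumes "finite S" "indep S" "finite T" "S \<subseteq> cl T"
  shows "card S \<le> card T"
  using Steinitz[OF assms] by auto

lemma indep_family:
  assumes "\<And>i. i \<in> I \<Longrightarrow> b i \<notin> cl (b ` (I - {i}))"
  shows "inj_on b I" "indep (b ` I)"
proof -
  show inj: "inj_on b I"
  proof (rule inj_onI, rule ccontr)
    fix i j assume "i \<in> I" "j \<in> I" "b i = b j" "i \<noteq> j"
    then have "b i \<in> b ` (I - {i})" by auto
    then show False using assms[OF \<open>i \<in> I\<close>] subset_cl[of "b ` (I - {i})"] by (meson subsetD)
  qed
  have "b ` I - {b i} = b ` (I - {i})" if "i \<in> I" for i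
    using inj_on_image_set_diff[OF inj, of I "{i}"] that by auto
  then show "indep (b ` I)" unfolding indep_def using assms by auto
qed

end

section \<open>Maximal ideals\<close>

definition is_ideal :: "'a::comm_ring_1 set \<Rightarrow> bool" where
  "is_ideal I \<longleftrightarrow> 0 \<in> I \<and> (\<forall>a\<in>I. \<forall>b\<in>I. a + b \<in> I) \<and> (\<forall>a\<in>I. \<forall>c. c * a \<in> I)"

text \<open>Maximality is expressed by the quotient being a field.\<close>
locale maximal_ideal =
  fixes \<mm> :: "'a::comm_ring_1 set"
  assumes ideal: "is_ideal \<mm>"
    and proper: "1 \<notin> \<mm>"
    and inverse_mod: "a \<notin> \<mm> \<Longrightarrow> \<exists>b. 1 - b * a \<in> \<mm>"
begin

lemma zero_mem [simp]: "0 \<in> \<mm>"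
  and add_mem: "a \<in> \<mm> \<Longrightarrow> b \<in> \<mm> \<Longrightarrow> a + b \<in> \<mm>"
  and mult_mem: "a \<in> \<mm> \<Longrightarrow> c * a \<in> \<mm>"
  using ideal by (auto simp: is_ideal_def)

lemma mult_mem2: "a \<in> \<mm> \<Longrightarrow> a * c \<in> \<mm>"
  using mult_mem by (simp add: mult.commute)

lemma sum_mem: "(\<And>i. i \<in> I \<Longrightarrow> f i \<in> \<mm>) \<Longrightarrow> sum f I \<in> \<mm>"
  by (induction I rule: infinite_finite_induct) (auto intro: add_mem)

lemma mult_notin:
  assumes "a \<notin> \<mm>" "b \<notin> \<mm>"
  shows "a * b \<notin> \<mm>"
proof
  assume ab: "a * b \<in> \<mm>"
  obtain a' where "1 - a' * a \<in> \<mm>" using inverse_mod assms(1) by blast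
  then have "b * (1 - a' * a) \<in> \<mm>" by (rule mult_mem)
  then have "b * (1 - a' * a) + a' * (a * b) \<in> \<mm>" using add_mem mult_mem[OF ab] by blast
  then show False using assms(2) by (simp add: algebra_simps)
qed

lemma power_notin: "a \<notin> \<mm> \<Longrightarrow> a ^ n \<notin> \<mm>"
  using proper by (induction n) (auto dest: mult_notin)

lemma prod_cong_mod:
  assumes "\<And>i. i \<in> I \<Longrightarrow> f i - g i \<in> \<mm>"
  shows "prod f I - prod g I \<in> \<mm>"
  using assms
proof (induction I rule: infinite_finite_induct)
  case (insert i I)
  have "f i * prod f I - g i * prod g I
      = prod f I * (f i - g i) + g i * (prod f I - prod g I)" by (simp add: algebra_simps)
  also have "\<dots> \<in> \<mm>" using insert by (intro add_mem mult_mem) auto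
  finally show ?case using insert by simp
qed auto

lemma det_cong_mod:
  assumes "A \<in> carrier_mat n n" "B \<in> carrier_mat n n"
    and "\<And>i j. i < n \<Longrightarrow> j < n \<Longrightarrow> A $$ (i, j) - B $$ (i, j) \<in> \<mm>"
  shows "det A - det B \<in> \<mm>"
proof -
  have "det A - det B = (\<Sum>p\<in>{p. p permutes {0..<n}}.
      signof p * ((\<Prod>i = 0..<n. A $$ (i, p i)) - (\<Prod>i = 0..<n. B $$ (i, p i))))"
    using assms(1,2) by (simp add: det_def' sum_subtractf right_diff_distrib)
  also have "\<dots> \<in> \<mm>"
    using assms(3) by (intro sum_mem mult_mem prod_cong_mod) (auto simp: permutes_in_image)
  finally show ?thesis .
qed

end

text \<open>
  In an ideal \<open>M\<close> that is maximal among the proper ones containing \<open>I\<close>, an element \<open>a \<notin> M\<close>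
  is invertible modulo \<open>M\<close> because \<open>M + A a\<close> contains \<open>1\<close>.
\<close>
lemma maximal_ideal_exists:
  fixes I :: "'a::comm_ring_1 set"
  assumes "is_ideal I" "1 \<notin> I"
  obtains \<mm> where "I \<subseteq> \<mm>" "maximal_ideal \<mm>"
proof -
  let ?P = "{J. is_ideal J \<and> I \<subseteq> J \<and> 1 \<notin> J}"
  have "\<exists>M\<in>?P. \<forall>J\<in>?P. M \<subseteq> J \<longrightarrow> J = M"
  proof (rule subset_Zorn_nonempty)
    show "?P \<noteq> {}" using assms by auto
  next
    fix C assume C: "C \<noteq> {}" "subset.chain ?P C"
    have CP: "C \<subseteq> ?P" using C(2) by (simp add: subset.chain_def)
    have tot: "J \<subseteq> K \<or> K \<subseteq> J" if "J \<in> C" "K \<in> C" for J K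
      using C(2) that by (auto simp: subset_chain_def)
    have "is_ideal (\<Union>C)"
      unfolding is_ideal_def
    proof (intro conjI ballI allI)
      show "0 \<in> \<Union>C" using C(1) CP by (auto simp: is_ideal_def)
    next
      fix a b assume "a \<in> \<Union>C" "b \<in> \<Union>C"
      then obtain J K where JK: "J \<in> C" "K \<in> C" "a \<in> J" "b \<in> K" by auto
      obtain L where "L \<in> C" "a \<in> L" "b \<in> L" using tot[OF JK(1,2)] JK by auto
      then show "a + b \<in> \<Union>C" using CP unfolding is_ideal_def by blast
    next
      fix a c assume "a \<in> \<Union>C"
      then show "c * a \<in> \<Union>C" using CP unfolding is_ideal_def by blast
    qed
    then show "\<Union>C \<in> ?P" using C(1) CP by auto
  qed
  then obtain M where M: "is_ideal M" "I \<subseteq> M" "1 \<notin> M"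
    and max: "\<And>J. is_ideal J \<Longrightarrow> 1 \<notin> J \<Longrightarrow> M \<subseteq> J \<Longrightarrow> J = M"
    by auto
  have "\<exists>b. 1 - b * a \<in> M" if a: "a \<notin> M" for a
  proof (rule ccontr)
    assume neg: "\<nexists>b. 1 - b * a \<in> M"
    let ?J = "{m + b * a | m b. m \<in> M}"
    have "is_ideal ?J"
      unfolding is_ideal_def
    proof (intro conjI ballI allI)
      show "0 \<in> ?J" using M(1) by (auto simp: is_ideal_def intro!: exI[of _ 0])
    next
      fix u v assume "u \<in> ?J" "v \<in> ?J"
      then obtain m b n c where "u = m + b * a" "v = n + c * a" "m \<in> M" "n \<in> M" by auto
      then show "u + v \<in> ?J" using M(1)
        by (intro CollectI exI[of _ "m + n"] exI[of _ "b + c"])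
          (auto simp: is_ideal_def algebra_simps)
    next
      fix u e assume "u \<in> ?J"
      then obtain m b where "u = m + b * a" "m \<in> M" by auto
      then show "e * u \<in> ?J" using M(1)
        by (intro CollectI exI[of _ "e * m"] exI[of _ "e * b"])
          (auto simp: is_ideal_def algebra_simps)
    qed
    moreover have "1 \<notin> ?J"
    proof
      assume "1 \<in> ?J"
      then obtain m b where "1 = m + b * a" "m \<in> M" by auto
      then have "1 - b * a \<in> M" by (metis add_diff_cancel_right')
      then show False using neg by blast
    qed
    moreover have "M \<subseteq> ?J"
    proof
      fix m assume "m \<in> M"
      then show "m \<in> ?J" by (intro CollectI exI[of _ m] exI[of _ 0]) simp
    qed
    ultimately have "?J = M" by (rule max)
    moreover have "a \<in> ?J" using M(1)
      by (intro CollectI exI[of _ 0] exI[of _ 1]) (simp add: is_ideal_def)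
    ultimately show False using a by blast
  qed
  then have "maximal_ideal M" using M by unfold_locales auto
  then show ?thesis using that M(2) by blast
qed

section \<open>Reduction of a module modulo a maximal ideal\<close>

context Modules.module
begin

text \<open>
  Both conditions in \<open>basis_over\<close> are invariant under multiplication by the unit \<open>f\<close> of \<open>A\<^sub>f\<close>, so
  denominators can be cleared.
\<close>
lemma basis_over_iff:
  assumes V: "subspace V"
  shows "basis_over scale f X V b I \<longleftrightarrow>
     finite I \<and> b ` I \<subseteq> X \<and>
     (\<forall>m\<in>X. \<exists>c N. scale (f ^ N) m - (\<Sum>i\<in>I. scale (c i) (b i)) \<in> V) \<and>
     (\<forall>c. (\<Sum>i\<in>I. scale (c i) (b i)) \<in> V \<longrightarrow> (\<forall>i\<in>I. \<exists>N. f ^ N * c i = 0))"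
    (is "_ \<longleftrightarrow> _ \<and> _ \<and> ?sp \<and> ?ind")
proof -
  have scale_sum: "scale a (\<Sum>i\<in>I. scale (c i) (b i)) = (\<Sum>i\<in>I. scale (a * c i) (b i))" for a c
    by (simp add: scale_sum_right)
  have "(\<forall>m\<in>X. \<forall>p. \<exists>c q. frac_eq scale f V (m, p) (\<Sum>i\<in>I. scale (c i) (b i), q)) \<longleftrightarrow> ?sp"
  proof (intro iffI ballI allI)
    fix m assume *: "\<forall>m\<in>X. \<forall>p. \<exists>c q. frac_eq scale f V (m, p) (\<Sum>i\<in>I. scale (c i) (b i), q)"
      and m: "m \<in> X"
    obtain c q N where
      "scale (f ^ N) (scale (f ^ q) m - scale (f ^ 0) (\<Sum>i\<in>I. scale (c i) (b i))) \<in> V"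
      using *[rule_format, OF m, of 0] by (auto simp: frac_eq_def)
    then have "scale (f ^ (N + q)) m - (\<Sum>i\<in>I. scale (f ^ N * c i) (b i)) \<in> V"
      by (simp add: scale_right_diff_distrib scale_sum power_add)
    then show "\<exists>c N. scale (f ^ N) m - (\<Sum>i\<in>I. scale (c i) (b i)) \<in> V"
      by (intro exI[of _ "\<lambda>i. f ^ N * c i"] exI[of _ "N + q"])
  next
    fix m p assume ?sp and m: "m \<in> X"
    then obtain c N where "scale (f ^ N) m - (\<Sum>i\<in>I. scale (c i) (b i)) \<in> V" by blast
    then have "scale (f ^ p) (scale (f ^ N) m - (\<Sum>i\<in>I. scale (c i) (b i))) \<in> V"
      using V by (intro subspace_scale)
    then have "frac_eq scale f V (m, p) (\<Sum>i\<in>I. scale (c i) (b i), p + N)"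
      by (auto simp: frac_eq_def scale_right_diff_distrib power_add intro!: exI[of _ 0])
    then show "\<exists>c q. frac_eq scale f V (m, p) (\<Sum>i\<in>I. scale (c i) (b i), q)" by blast
  qed
  moreover have "(\<forall>c q. frac_eq scale f V (\<Sum>i\<in>I. scale (c i) (b i), q) (0, 0) \<longrightarrow>
        (\<forall>i\<in>I. frac_eq (*) f {0} (c i, q) (0, 0))) \<longleftrightarrow> ?ind"
  proof (intro iffI allI impI ballI)
    fix c i
    assume *: "\<forall>c q. frac_eq scale f V (\<Sum>i\<in>I. scale (c i) (b i), q) (0, 0) \<longrightarrow>
        (\<forall>i\<in>I. frac_eq (*) f {0} (c i, q) (0, 0))"
      and c: "(\<Sum>i\<in>I. scale (c i) (b i)) \<in> V" and i: "i \<in> I"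
    have "frac_eq scale f V (\<Sum>i\<in>I. scale (c i) (b i), 0) (0, 0)"
      using c by (auto simp: frac_eq_def intro!: exI[of _ 0])
    then have "frac_eq (*) f {0} (c i, 0) (0, 0)" using *[rule_format] i by blast
    then show "\<exists>N. f ^ N * c i = 0" by (auto simp: frac_eq_def)
  next
    fix c q i
    assume ?ind and fr: "frac_eq scale f V (\<Sum>i\<in>I. scale (c i) (b i), q) (0, 0)" and i: "i \<in> I"
    from fr obtain N where "(\<Sum>i\<in>I. scale (f ^ N * c i) (b i)) \<in> V"
      by (auto simp: frac_eq_def scale_sum)
    then have "\<forall>i\<in>I. \<exists>M. f ^ M * (f ^ N * c i) = 0" by (rule \<open>?ind\<close>[THEN spec, THEN mp])
    then obtain M where "f ^ M * (f ^ N * c i) = 0" using i by blast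
    then show "frac_eq (*) f {0} (c i, q) (0, 0)"
      by (auto simp: frac_eq_def power_add mult.assoc intro!: exI[of _ "M + N"])
  qed
  ultimately show ?thesis unfolding basis_over_def by blast
qed

lemma span_image_Un:
  assumes "finite I" "subspace W" "v \<in> span (b ` I \<union> W)"
  shows "\<exists>c. v - (\<Sum>i\<in>I. scale (c i) (b i)) \<in> W"
  using assms(3)
proof (induction rule: span_induct_alt)
  case base
  then show ?case using assms(2) by (intro exI[of _ "\<lambda>_. 0"]) (simp add: subspace_0)
next
  case (step a x y)
  then obtain c where c: "y - (\<Sum>i\<in>I. scale (c i) (b i)) \<in> W" by blast
  from step consider "x \<in> W" | i where "i \<in> I" "x = b i" by blast
  then show ?case
  proof cases
    case 1
    have "scale a x + (y - (\<Sum>i\<in>I. scale (c i) (b i))) \<in> W"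
      using assms(2) 1 c by (intro subspace_add subspace_scale)
    then show ?thesis by (auto simp: algebra_simps intro!: exI[of _ c])
  next
    case 2
    have "(\<Sum>j\<in>I. scale ((c(i := c i + a)) j) (b j)) =
        scale (c i + a) (b i) + (\<Sum>j\<in>I - {i}. scale (c j) (b j))"
      using assms(1) 2 by (subst sum.remove[of I i]) (auto intro!: sum.cong)
    also have "\<dots> = scale a (b i) + (\<Sum>j\<in>I. scale (c j) (b j))"
      using sum.remove[OF assms(1) 2(1), of "\<lambda>j. scale (c j) (b j)"]
      by (simp add: scale_left_distrib)
    finally show ?thesis using c 2 by (intro exI[of _ "c(i := c i + a)"]) simp
  qed
qed

end

text \<open>
  \<open>W\<close> contains \<open>V\<close> and all multiples by \<open>\<mm>\<close>, so that the ambient module modulo \<open>W\<close> is a vector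
  space over \<open>A/\<mm>\<close>; \<open>cl B\<close> below is the preimage of the subspace spanned by \<open>B\<close>.
\<close>
locale residue_module = Modules.module scale + maximal_ideal \<mm>
  for scale :: "'a::comm_ring_1 \<Rightarrow> 'm::ab_group_add \<Rightarrow> 'm" and \<mm> :: "'a set" +
  fixes V W :: "'m set"
  assumes subspace_V: "subspace V" and subspace_W: "subspace W"
    and V_le_W: "V \<subseteq> W"
    and scale_mem_W: "a \<in> \<mm> \<Longrightarrow> scale a v \<in> W"
begin

definition cl :: "'m set \<Rightarrow> 'm set" where
  "cl B = span (B \<union> W)"

lemma subspace_cl: "subspace (cl B)"
  unfolding cl_def by (rule subspace_span)

lemma W_subset_cl: "W \<subseteq> cl B"
  unfolding cl_def using span_superset by blast

lemma cl_empty [simp]: "cl {} = W"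
  unfolding cl_def using subspace_W by (simp add: span_eq_iff)

lemma cl_minimal: "B \<subseteq> Y \<Longrightarrow> W \<subseteq> Y \<Longrightarrow> subspace Y \<Longrightarrow> cl B \<subseteq> Y"
  unfolding cl_def by (intro span_minimal) auto

sublocale exchange_closure cl
proof
  fix A B :: "'m set" and v w
  show "B \<subseteq> cl B" unfolding cl_def using span_superset by blast
  show "cl A \<subseteq> cl B" if "A \<subseteq> cl B"
    using cl_minimal[OF that W_subset_cl subspace_cl] .
  assume v: "v \<notin> cl B" and vw: "v \<in> cl (insert w B)"
  obtain k where k: "v - scale k w \<in> cl B"
    using vw by (auto simp: cl_def span_breakdown_eq)
  have "k \<notin> \<mm>"
  proof
    assume "k \<in> \<mm>"
    then have "scale k w \<in> cl B" using scale_mem_W W_subset_cl by blast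
    then have "v - scale k w + scale k w \<in> cl B" using k subspace_cl by (intro subspace_add)
    then show False using v by simp
  qed
  then obtain l where l: "1 - l * k \<in> \<mm>" using inverse_mod by blast
  have "scale (1 - l * k) w - scale l (v - scale k w) \<in> cl B"
    using subspace_diff[OF subspace_cl subsetD[OF W_subset_cl scale_mem_W[OF l]]
        subspace_scale[OF subspace_cl k]] .
  then have "w - scale l v \<in> cl B" by (simp add: algebra_simps)
  then show "w \<in> cl (insert v B)" by (auto simp: cl_def span_breakdown_eq)
qed

lemma mem_cl_unit:
  assumes "a \<notin> \<mm>" "scale a v \<in> cl B"
  shows "v \<in> cl B"
proof -
  obtain c where c: "1 - c * a \<in> \<mm>" using inverse_mod assms(1) by blast
  have "scale (1 - c * a) v + scale c (scale a v) \<in> cl B"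
    using subspace_add[OF subspace_cl subsetD[OF W_subset_cl scale_mem_W[OF c]]
        subspace_scale[OF subspace_cl assms(2)]] .
  then show ?thesis by (simp add: algebra_simps)
qed

text \<open>
  \<open>X / V\<close> is free of rank \<open>d\<close> over \<open>A\<^sub>g\<close>, a localization that does not lose the point \<open>\<mm>\<close>. By the
  last clause \<open>W\<close> cuts out nothing more on \<open>X\<close> than \<open>V + \<mm>X\<close>, so that the image of \<open>X\<close> modulo \<open>W\<close>
  is the fibre of \<open>X / V\<close> at \<open>\<mm>\<close>.
\<close>
definition free_at :: "nat \<Rightarrow> 'm set \<Rightarrow> 'a \<Rightarrow> (nat \<Rightarrow> 'm) \<Rightarrow> bool" where
  "free_at d X g b \<longleftrightarrow> subspace X \<and> g \<notin> \<mm> \<and> basis_over scale g X V b {..<d} \<and>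
     (\<forall>w\<in>X \<inter> W. \<exists>v\<in>V. w - v \<in> span {scale a x | a x. a \<in> \<mm> \<and> x \<in> X})"

lemma free_at_span:
  assumes "free_at d X g b" "m \<in> X"
  obtains c N where "scale (g ^ N) m - (\<Sum>i<d. scale (c i) (b i)) \<in> V"
  using assms unfolding free_at_def basis_over_iff[OF subspace_V] by blast

lemma free_at_indep:
  assumes "free_at d X g b" "(\<Sum>i<d. scale (c i) (b i)) \<in> V" "i < d"
  obtains N where "g ^ N * c i = 0"
  using assms unfolding free_at_def basis_over_iff[OF subspace_V] by blast

text \<open>Vanishing in the fibre means that the coordinates with respect to \<open>b\<close> lie in \<open>\<mm>\<close>.\<close>
lemma free_at_W:
  assumes F: "free_at d X g b" and w: "w \<in> X" "w \<in> W"
  shows "\<exists>c N. (\<forall>i<d. c i \<in> \<mm>) \<and> scale (g ^ N) w - (\<Sum>i<d. scale (c i) (b i)) \<in> V"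
proof -
  obtain v where v: "v \<in> V" and wv: "w - v \<in> span {scale a x | a x. a \<in> \<mm> \<and> x \<in> X}"
    using F w unfolding free_at_def by blast
  define P where "P u \<longleftrightarrow>
    (\<exists>c N. (\<forall>i<d. c i \<in> \<mm>) \<and> scale (g ^ N) u - (\<Sum>i<d. scale (c i) (b i)) \<in> V)" for u
  have "P u" if "u \<in> span {scale a x | a x. a \<in> \<mm> \<and> x \<in> X}" for u
    using that
  proof (induction rule: span_induct_alt)
    case base
    then show ?case unfolding P_def
      using subspace_V by (intro exI[of _ "\<lambda>_. 0"]) (auto simp: subspace_0)
  next
    case (step e y u)
    then obtain a x where ax: "y = scale a x" "a \<in> \<mm>" "x \<in> X" by blast
    obtain c N where c: "\<forall>i<d. c i \<in> \<mm>"
        "scale (g ^ N) u - (\<Sum>i<d. scale (c i) (b i)) \<in> V"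
      using step by (auto simp: P_def)
    obtain k M where k: "scale (g ^ M) x - (\<Sum>i<d. scale (k i) (b i)) \<in> V"
      using free_at_span[OF F ax(3)] .
    have "scale (g ^ N * (e * a)) (scale (g ^ M) x - (\<Sum>i<d. scale (k i) (b i))) +
        scale (g ^ M) (scale (g ^ N) u - (\<Sum>i<d. scale (c i) (b i))) \<in> V" (is "?z \<in> V")
      using k c(2) subspace_V by (intro subspace_add subspace_scale)
    moreover have "?z = scale (g ^ (N + M)) (scale e y + u) -
        (\<Sum>i<d. scale (g ^ N * (e * a) * k i + g ^ M * c i) (b i))"
      by (simp add: ax(1) scale_right_diff_distrib scale_right_distrib scale_left_distrib
          scale_sum_right sum.distrib power_add mult_ac)
    moreover have "\<forall>i<d. g ^ N * (e * a) * k i + g ^ M * c i \<in> \<mm>"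
      using c(1) add_mem[OF mult_mem2[OF mult_mem[OF mult_mem[OF ax(2)]]] mult_mem] by blast
    ultimately show ?case unfolding P_def
      by (intro exI[of _ "\<lambda>i. g ^ N * (e * a) * k i + g ^ M * c i"] exI[of _ "N + M"]) simp
  qed
  then have "P (w - v)" using wv by blast
  then obtain c N where c: "\<forall>i<d. c i \<in> \<mm>"
      "scale (g ^ N) (w - v) - (\<Sum>i<d. scale (c i) (b i)) \<in> V"
    by (auto simp: P_def)
  have "scale (g ^ N) (w - v) - (\<Sum>i<d. scale (c i) (b i)) + scale (g ^ N) v \<in> V"
    using c(2) v subspace_V by (intro subspace_add subspace_scale)
  then have "scale (g ^ N) w - (\<Sum>i<d. scale (c i) (b i)) \<in> V"
    by (simp add: algebra_simps)
  then show ?thesis using c(1) by blast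
qed

lemma free_at_generates:
  assumes F: "free_at d X g b"
  shows "X \<subseteq> cl (b ` {..<d})"
proof
  fix m assume "m \<in> X"
  then obtain c N where "scale (g ^ N) m - (\<Sum>i<d. scale (c i) (b i)) \<in> V"
    using free_at_span[OF F] by blast
  then have "scale (g ^ N) m - (\<Sum>i<d. scale (c i) (b i)) \<in> cl (b ` {..<d})"
    using V_le_W W_subset_cl by blast
  moreover have "(\<Sum>i<d. scale (c i) (b i)) \<in> cl (b ` {..<d})"
    using subset_cl[of "b ` {..<d}"] by (intro subspace_sum[OF subspace_cl] subspace_scale[OF subspace_cl]) auto
  ultimately have "scale (g ^ N) m - (\<Sum>i<d. scale (c i) (b i)) + (\<Sum>i<d. scale (c i) (b i))
      \<in> cl (b ` {..<d})"
    using subspace_cl by (intro subspace_add)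
  then have "scale (g ^ N) m \<in> cl (b ` {..<d})" by simp
  then show "m \<in> cl (b ` {..<d})"
    using F mem_cl_unit[OF power_notin] by (auto simp: free_at_def)
qed

text \<open>
  A dependence in the fibre would give a relation over \<open>A\<^sub>g\<close> in which the coefficient of \<open>b i\<close> is a
  power of \<open>g\<close> modulo \<open>\<mm>\<close>, while freeness forces this coefficient to vanish in \<open>A\<^sub>g\<close>.
\<close>
lemma free_at_residue_indep:
  assumes F: "free_at d X g b" and i: "i < d"
  shows "b i \<notin> cl (b ` ({..<d} - {i}))"
proof
  assume "b i \<in> cl (b ` ({..<d} - {i}))"
  then obtain c where c: "b i - (\<Sum>j\<in>{..<d} - {i}. scale (c j) (b j)) \<in> W"
    using span_image_Un[OF _ subspace_W, of "{..<d} - {i}"] unfolding cl_def by auto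
  have bX: "b j \<in> X" if "j < d" for j
    using F that by (auto simp: free_at_def basis_over_def)
  have X: "subspace X" using F by (simp add: free_at_def)
  define e where "e = (\<lambda>j. if j = i then 1 else - c j)"
  have e: "b i - (\<Sum>j\<in>{..<d} - {i}. scale (c j) (b j)) = (\<Sum>j<d. scale (e j) (b j))"
    using i by (subst sum.remove[of "{..<d}" i]) (auto simp: e_def sum_negf)
  have "(\<Sum>j<d. scale (e j) (b j)) \<in> X"
    using X bX by (intro subspace_sum subspace_scale) auto
  from free_at_W[OF F this] c e obtain m N where m: "\<forall>j<d. m j \<in> \<mm>"
    and "scale (g ^ N) (\<Sum>j<d. scale (e j) (b j)) - (\<Sum>j<d. scale (m j) (b j)) \<in> V"
    by auto
  then have "(\<Sum>j<d. scale (g ^ N * e j - m j) (b j)) \<in> V"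
    by (simp add: scale_sum_right scale_left_diff_distrib sum_subtractf)
  from free_at_indep[OF F this i] obtain M where "g ^ M * (g ^ N * e i - m i) = 0" .
  then have "g ^ (M + N) = g ^ M * m i" by (simp add: e_def algebra_simps power_add)
  then have "g ^ (M + N) \<in> \<mm>" using m i by (auto intro: mult_mem)
  then show False using F power_notin by (auto simp: free_at_def)
qed

text \<open>The next two lemmas say that the fibre has dimension \<open>d\<close>.\<close>
lemma card_indep_le_rank:
  assumes F: "free_at d X g b" and S: "finite S" "indep S" "S \<subseteq> X"
  shows "card S \<le> d"
proof -
  have "card S \<le> card (b ` {..<d})"
    using S free_at_generates[OF F] by (intro card_indep_le) auto
  also have "\<dots> \<le> d" using card_image_le[of "{..<d}" b] by simp
  finally show ?thesis .
qed

lemma rank_le_card_generators: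
  assumes F: "free_at d X g b" and T: "finite T" "X \<subseteq> cl T"
  shows "d \<le> card T"
proof -
  have ind: "b i \<notin> cl (b ` ({..<d} - {i}))" if "i \<in> {..<d}" for i
    using free_at_residue_indep[OF F] that by simp
  have "card (b ` {..<d}) \<le> card T"
    using indep_family(2)[OF ind] F T
    by (intro card_indep_le) (auto simp: free_at_def basis_over_def)
  then show ?thesis using card_image[OF indep_family(1)[OF ind]] by simp
qed

lemma basis_over_reindex:
  assumes \<pi>: "bij_betw \<pi> J I" and B: "basis_over scale f X V (\<lambda>j. t (\<pi> j)) J"
  shows "basis_over scale f X V t I"
proof -
  have re: "(\<Sum>j\<in>J. scale (c (\<pi> j)) (t (\<pi> j))) = (\<Sum>i\<in>I. scale (c i) (t i))" for c
    using \<pi> by (rule sum.reindex_bij_betw)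
  have inv: "inv_into J \<pi> (\<pi> j) = j" if "j \<in> J" for j
    using \<pi> that by (simp add: bij_betw_inv_into_left)
  note B' = B[unfolded basis_over_iff[OF subspace_V]]
  have sp: "\<forall>m\<in>X. \<exists>c N. scale (f ^ N) m - (\<Sum>j\<in>J. scale (c j) (t (\<pi> j))) \<in> V"
    and ind: "\<forall>c. (\<Sum>j\<in>J. scale (c j) (t (\<pi> j))) \<in> V \<longrightarrow> (\<forall>j\<in>J. \<exists>N. f ^ N * c j = 0)"
    by (rule B'[THEN conjunct2, THEN conjunct2, THEN conjunct1],
        rule B'[THEN conjunct2, THEN conjunct2, THEN conjunct2])
  have "\<exists>c N. scale (f ^ N) m - (\<Sum>i\<in>I. scale (c i) (t i)) \<in> V" if m: "m \<in> X" for m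
  proof -
    obtain c N where "scale (f ^ N) m - (\<Sum>j\<in>J. scale (c j) (t (\<pi> j))) \<in> V"
      using sp[rule_format, OF m] by (elim exE)
    moreover have "(\<Sum>j\<in>J. scale (c j) (t (\<pi> j))) = (\<Sum>i\<in>I. scale (c (inv_into J \<pi> i)) (t i))"
      using inv by (subst re[symmetric]) (auto intro!: sum.cong)
    ultimately show ?thesis by metis
  qed
  moreover have "\<forall>i\<in>I. \<exists>N. f ^ N * c i = 0" if "(\<Sum>i\<in>I. scale (c i) (t i)) \<in> V" for c
  proof -
    have "(\<Sum>j\<in>J. scale (c (\<pi> j)) (t (\<pi> j))) \<in> V" using that re by simp
    then have "\<forall>j\<in>J. \<exists>N. f ^ N * c (\<pi> j) = 0" by (rule ind[THEN spec, THEN mp])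
    then show ?thesis using \<pi> by (auto simp: bij_betw_def)
  qed
  moreover have "finite I" "t ` I \<subseteq> X" using B' \<pi> bij_betw_finite
    by (auto simp: bij_betw_def)
  ultimately show ?thesis unfolding basis_over_iff[OF subspace_V] by blast
qed

text \<open>
  The lifting of a basis from the fibre, as in Nakayama's lemma. Let \<open>P\<close> be the matrix that expresses
  \<open>g\<^sup>N s\<close> in terms of \<open>b\<close>, and \<open>R\<close> a matrix that expresses \<open>b\<close> in terms of \<open>s\<close> in the fibre. Then
  \<open>R P\<close> is congruent to \<open>g\<^sup>N\<close> times the identity modulo \<open>\<mm>\<close>, whence \<open>D = det P\<close> is not in \<open>\<mm>\<close>. By
  Cramer's rule \<open>s\<close> is a basis as soon as \<open>g\<close> and \<open>D\<close> are invertible.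
\<close>
lemma free_at_lift_aux:
  assumes F: "free_at d X g b" and s: "s ` {..<d} \<subseteq> X" "X \<subseteq> cl (s ` {..<d})"
  shows "\<exists>f. f \<notin> \<mm> \<and> basis_over scale f X V s {..<d}"
proof -
  have X: "subspace X" and g: "g \<notin> \<mm>" and bX: "\<And>j. j < d \<Longrightarrow> b j \<in> X"
    using F by (auto simp: free_at_def basis_over_def)
  have "\<exists>c N. scale (g ^ N) (s i) - (\<Sum>j<d. scale (c j) (b j)) \<in> V" if "i < d" for i
  proof -
    have "s i \<in> X" using s(1) that by auto
    then show ?thesis using free_at_span[OF F] by blast
  qed
  then obtain P0 n where P0:
    "\<And>i. i < d \<Longrightarrow> scale (g ^ n i) (s i) - (\<Sum>j<d. scale (P0 i j) (b j)) \<in> V"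
    by metis
  define N where "N = (\<Sum>i<d. n i)"
  define P where "P i j = g ^ (N - n i) * P0 i j" for i j
  have P: "scale (g ^ N) (s i) - (\<Sum>j<d. scale (P i j) (b j)) \<in> V" if "i < d" for i
  proof -
    have "n i \<le> N" unfolding N_def using that by (intro member_le_sum) auto
    then have "g ^ (N - n i) * g ^ n i = g ^ N" by (simp flip: power_add)
    moreover have "scale (g ^ (N - n i)) (scale (g ^ n i) (s i) - (\<Sum>j<d. scale (P0 i j) (b j))) \<in> V"
      using P0[OF that] subspace_V by (intro subspace_scale)
    ultimately show ?thesis
      by (simp add: scale_right_diff_distrib scale_sum_right P_def)
  qed
  have "\<exists>c. b j - (\<Sum>i<d. scale (c i) (s i)) \<in> W" if "j < d" for j
    using s(2) bX[OF that] span_image_Un[OF _ subspace_W, of "{..<d}"] unfolding cl_def by auto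
  then obtain R where R: "\<And>j. j < d \<Longrightarrow> b j - (\<Sum>i<d. scale (R j i) (s i)) \<in> W" by metis
  \<comment> \<open>\<open>z\<close> is \<open>g\<^sup>N I - R P\<close>, which measures how far \<open>R\<close> is from inverting \<open>P / g\<^sup>N\<close>.\<close>
  define z where "z j k = (if j = k then g ^ N else 0) - (\<Sum>i<d. R j i * P i k)" for j k
  have z: "z j k \<in> \<mm>" if jk: "j < d" "k < d" for j k
  proof -
    have "b j - (\<Sum>i<d. scale (R j i) (s i)) \<in> X"
      using X bX jk(1) s(1) by (intro subspace_diff subspace_sum subspace_scale) auto
    from free_at_W[OF F this R[OF jk(1)]] obtain m M where m: "\<forall>k<d. m k \<in> \<mm>"
      and M: "scale (g ^ M) (b j - (\<Sum>i<d. scale (R j i) (s i))) - (\<Sum>k<d. scale (m k) (b k)) \<in> V"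
      by blast
    have "scale (g ^ N) (scale (g ^ M) (b j - (\<Sum>i<d. scale (R j i) (s i))) -
          (\<Sum>k<d. scale (m k) (b k))) +
        (\<Sum>i<d. scale (g ^ M * R j i) (scale (g ^ N) (s i) - (\<Sum>k<d. scale (P i k) (b k)))) \<in> V"
        (is "?v \<in> V")
      using M P subspace_V by (intro subspace_add subspace_scale subspace_sum) auto
    also have "?v = scale (g ^ M * g ^ N) (b j) - (\<Sum>k<d. scale (g ^ N * m k) (b k)) -
        (\<Sum>i<d. \<Sum>k<d. scale (g ^ M * R j i * P i k) (b k))"
      by (simp add: scale_right_diff_distrib scale_sum_right sum_subtractf mult_ac)
    also have "(\<Sum>i<d. \<Sum>k<d. scale (g ^ M * R j i * P i k) (b k)) =
        (\<Sum>k<d. scale (g ^ M * (\<Sum>i<d. R j i * P i k)) (b k))"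
      by (subst sum.swap) (simp add: sum_distrib_left scale_sum_left mult.assoc)
    also have "scale (g ^ M * g ^ N) (b j) = (\<Sum>k<d. scale (g ^ M * (if j = k then g ^ N else 0)) (b k))"
      using jk(1) by (subst sum.remove[of "{..<d}" j]) (auto intro!: sum.neutral)
    finally have "(\<Sum>k<d. scale (g ^ M * z j k - g ^ N * m k) (b k)) \<in> V"
      by (simp add: z_def scale_left_diff_distrib sum_subtractf right_diff_distrib algebra_simps
          sum.distrib)
    from free_at_indep[OF F this jk(2)]
    obtain L where "g ^ L * (g ^ M * z j k - g ^ N * m k) = 0" .
    then have "g ^ (L + M) * z j k = g ^ L * g ^ N * m k"
      by (simp add: algebra_simps power_add)
    then have "g ^ (L + M) * z j k \<in> \<mm>" using m jk(2) by (auto intro: mult_mem)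
    then show ?thesis using mult_notin power_notin[OF g] by blast
  qed
  define PM where "PM = mat d d (\<lambda>(i, j). P i j)"
  define RM where "RM = mat d d (\<lambda>(i, j). R i j)"
  have carr: "PM \<in> carrier_mat d d" "RM \<in> carrier_mat d d" by (auto simp: PM_def RM_def)
  define D where "D = det PM"
  have "det (g ^ N \<cdot>\<^sub>m 1\<^sub>m d) - det (RM * PM) \<in> \<mm>"
  proof (rule det_cong_mod[of _ d])
    fix i j assume ij: "i < d" "j < d"
    have "(g ^ N \<cdot>\<^sub>m 1\<^sub>m d) $$ (i, j) - (RM * PM) $$ (i, j) = z i j"
      using ij by (simp add: z_def RM_def PM_def scalar_prod_def atLeast0LessThan)
    then show "(g ^ N \<cdot>\<^sub>m 1\<^sub>m d) $$ (i, j) - (RM * PM) $$ (i, j) \<in> \<mm>" using z ij by simp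
  qed (use carr in auto)
  then have "(g ^ N) ^ d - det RM * D \<in> \<mm>"
    using carr by (simp add: det_smult D_def det_mult)
  then have D: "D \<notin> \<mm>"
    using power_notin[OF power_notin[OF g]] add_mem mult_mem by (metis diff_add_cancel)
  define A where "A = adj_mat PM"
  have Acarr: "A \<in> carrier_mat d d" and PA: "PM * A = D \<cdot>\<^sub>m 1\<^sub>m d" and AP: "A * PM = D \<cdot>\<^sub>m 1\<^sub>m d"
    using adj_mat[OF carr(1)] by (auto simp: A_def D_def)
  have AP': "(\<Sum>i<d. A $$ (k, i) * P i j) = (if k = j then D else 0)" if "k < d" "j < d" for k j
  proof -
    have "(A * PM) $$ (k, j) = (\<Sum>i<d. A $$ (k, i) * P i j)"
      using that Acarr by (simp add: PM_def scalar_prod_def atLeast0LessThan)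
    then show ?thesis using that by (cases "k = j") (auto simp: AP)
  qed
  have PA': "(\<Sum>j<d. P i j * A $$ (j, k)) = (if i = k then D else 0)" if "k < d" "i < d" for k i
  proof -
    have "(PM * A) $$ (i, k) = (\<Sum>j<d. P i j * A $$ (j, k))"
      using that Acarr by (simp add: PM_def scalar_prod_def atLeast0LessThan)
    then show ?thesis using that by (cases "i = k") (auto simp: PA)
  qed
  have Db: "scale D (b k) - (\<Sum>i<d. scale (A $$ (k, i) * g ^ N) (s i)) \<in> V" if k: "k < d" for k
  proof -
    have "- (\<Sum>i<d. scale (A $$ (k, i)) (scale (g ^ N) (s i) - (\<Sum>j<d. scale (P i j) (b j)))) \<in> V"
        (is "?v \<in> V")
      using P subspace_V by (intro subspace_neg subspace_sum subspace_scale) auto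
    also have "?v = (\<Sum>i<d. \<Sum>j<d. scale (A $$ (k, i) * P i j) (b j)) -
        (\<Sum>i<d. scale (A $$ (k, i) * g ^ N) (s i))"
      by (simp add: scale_right_diff_distrib scale_sum_right sum_subtractf)
    also have "(\<Sum>i<d. \<Sum>j<d. scale (A $$ (k, i) * P i j) (b j)) =
        (\<Sum>j<d. scale (\<Sum>i<d. A $$ (k, i) * P i j) (b j))"
      by (subst sum.swap) (simp add: scale_sum_left)
    also have "\<dots> = (\<Sum>j<d. scale (if k = j then D else 0) (b j))"
      using AP' k by simp
    also have "\<dots> = scale D (b k)"
      using k by (subst sum.remove[of "{..<d}" k]) (auto intro!: sum.neutral)
    finally show ?thesis .
  qed
  have "basis_over scale (g * D) X V s {..<d}"
    unfolding basis_over_iff[OF subspace_V]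
  proof (intro conjI ballI allI impI)
    fix m assume "m \<in> X"
    then obtain a q where a: "scale (g ^ q) m - (\<Sum>k<d. scale (a k) (b k)) \<in> V"
      using free_at_span[OF F] by blast
    have "scale (D ^ q * g) (scale D (scale (g ^ q) m - (\<Sum>k<d. scale (a k) (b k))) +
        (\<Sum>k<d. scale (a k) (scale D (b k) - (\<Sum>i<d. scale (A $$ (k, i) * g ^ N) (s i))))) \<in> V"
        (is "?v \<in> V")
      using a Db subspace_V by (intro subspace_add subspace_scale subspace_sum) auto
    also have "?v = scale ((g * D) ^ Suc q) m -
        scale (D ^ q * g) (\<Sum>k<d. \<Sum>i<d. scale (a k * (A $$ (k, i) * g ^ N)) (s i))"
      by (simp add: scale_right_diff_distrib scale_right_distrib scale_sum_right sum_subtractf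
          power_mult_distrib mult_ac)
    also have "(\<Sum>k<d. \<Sum>i<d. scale (a k * (A $$ (k, i) * g ^ N)) (s i)) =
        (\<Sum>i<d. scale (\<Sum>k<d. a k * (A $$ (k, i) * g ^ N)) (s i))"
      by (subst sum.swap) (simp add: scale_sum_left)
    finally have "scale ((g * D) ^ Suc q) m -
        (\<Sum>i<d. scale (D ^ q * g * (\<Sum>k<d. a k * (A $$ (k, i) * g ^ N))) (s i)) \<in> V"
      by (simp add: scale_sum_right)
    then show "\<exists>c N. scale ((g * D) ^ N) m - (\<Sum>i<d. scale (c i) (s i)) \<in> V"
      by (intro exI[of _ "\<lambda>i. D ^ q * g * (\<Sum>k<d. a k * (A $$ (k, i) * g ^ N))"] exI[of _ "Suc q"])
  next
    fix c k assume c: "(\<Sum>i<d. scale (c i) (s i)) \<in> V" and k: "k \<in> {..<d}"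
    have "scale (g ^ N) (\<Sum>i<d. scale (c i) (s i)) -
        (\<Sum>i<d. scale (c i) (scale (g ^ N) (s i) - (\<Sum>j<d. scale (P i j) (b j)))) \<in> V"
        (is "?v \<in> V")
      by (intro subspace_diff[OF subspace_V] subspace_scale[OF subspace_V c]
          subspace_sum[OF subspace_V] subspace_scale[OF subspace_V P]) simp
    also have "?v = (\<Sum>i<d. \<Sum>j<d. scale (c i * P i j) (b j))"
      by (simp add: scale_right_diff_distrib scale_sum_right sum_subtractf mult_ac)
    also have "\<dots> = (\<Sum>j<d. scale (\<Sum>i<d. c i * P i j) (b j))"
      by (subst sum.swap) (simp add: scale_sum_left)
    finally have *: "(\<Sum>j<d. scale (\<Sum>i<d. c i * P i j) (b j)) \<in> V" .
    have "\<exists>M. g ^ M * (\<Sum>i<d. c i * P i j) = 0" if "j < d" for j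
      using free_at_indep[OF F * that] by blast
    then obtain M0 where M0: "\<And>j. j < d \<Longrightarrow> g ^ M0 j * (\<Sum>i<d. c i * P i j) = 0" by metis
    define M where "M = (\<Sum>j<d. M0 j)"
    have M: "g ^ M * (\<Sum>i<d. c i * P i j) = 0" if "j < d" for j
    proof -
      have "M0 j \<le> M" unfolding M_def using that by (intro member_le_sum) auto
      then have "g ^ M = g ^ (M - M0 j) * g ^ M0 j" by (simp flip: power_add)
      then show ?thesis using M0[OF that] by (simp add: mult.assoc)
    qed
    have "0 = (\<Sum>j<d. g ^ M * (\<Sum>i<d. c i * P i j) * A $$ (j, k))" using M by simp
    also have "\<dots> = (\<Sum>j<d. \<Sum>i<d. g ^ M * c i * (P i j * A $$ (j, k)))"
      by (simp add: sum_distrib_left sum_distrib_right mult_ac)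
    also have "\<dots> = (\<Sum>i<d. g ^ M * c i * (\<Sum>j<d. P i j * A $$ (j, k)))"
      by (subst sum.swap) (simp add: sum_distrib_left)
    also have "\<dots> = (\<Sum>i<d. g ^ M * c i * (if i = k then D else 0))"
      using PA' k by simp
    also have "\<dots> = g ^ M * c k * D"
      using k by (subst sum.remove[of "{..<d}" k]) (auto intro!: sum.neutral)
    finally have 0: "g ^ M * c k * D = 0" by simp
    have "(g * D) ^ Suc M * c k = g * D ^ M * (g ^ M * c k * D)"
      by (simp add: power_mult_distrib mult_ac)
    then show "\<exists>M. (g * D) ^ M * c k = 0" using 0 by (metis mult_zero_right)
  qed (use s(1) in auto)
  moreover have "g * D \<notin> \<mm>" using g D by (rule mult_notin)
  ultimately show ?thesis by blast
qed

lemma free_at_lift: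
  assumes F: "free_at d X g b" and I: "finite I" "card I = d"
    and t: "t ` I \<subseteq> X" "X \<subseteq> cl (t ` I)"
  obtains f where "f \<notin> \<mm>" "basis_over scale f X V t I"
proof -
  obtain \<pi> where \<pi>: "bij_betw \<pi> {..<d} I"
    using I ex_bij_betw_nat_finite[of I] by (auto simp: atLeast0LessThan)
  then have "(\<lambda>j. t (\<pi> j)) ` {..<d} = t ` I" by (auto simp: bij_betw_def)
  then obtain f where "f \<notin> \<mm>" "basis_over scale f X V (\<lambda>j. t (\<pi> j)) {..<d}"
    using free_at_lift_aux[OF F, of "\<lambda>j. t (\<pi> j)"] t by auto
  then show ?thesis using basis_over_reindex[OF \<pi>] that by blast
qed

end

section \<open>Forms in two variables\<close>

abbreviation homogeneous :: "nat \<Rightarrow> 'a::comm_ring_1 poly poly \<Rightarrow> bool" where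
  "homogeneous n p \<equiv> hom_part n p = p"

lemma monomial_eq_monom:
  "const a * X_var ^ i * Y_var ^ j = monom (monom a i) j" for a :: "'a::comm_ring_1"
proof -
  have X: "X_var ^ i = [:monom (1::'a) i:]"
    by (induction i) (simp_all add: monom_Suc)
  have Y: "Y_var ^ j = (monom 1 j :: 'a poly poly)"
    by (simp add: monom_altdef)
  show ?thesis unfolding X Y by (simp add: smult_monom)
qed

lemma coeff_hom_part:
  "coeff (coeff (hom_part n p) j) i = (if i + j = n then coeff (coeff p j) i else 0)"
proof -
  have "coeff (coeff (hom_part n p) j) i =
      (\<Sum>l\<le>n. if l = j then (if n - l = i then coeff (coeff p l) (n - l) else 0) else 0)"
    unfolding hom_part_def monomial_eq_monom coeff_sum by (intro sum.cong) auto
  also have "\<dots> = (if j \<le> n then (if n - j = i then coeff (coeff p j) (n - j) else 0) else 0)"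
    by simp
  also have "\<dots> = (if i + j = n then coeff (coeff p j) i else 0)" by auto
  finally show ?thesis .
qed

lemma poly_poly_eqI:
  "(\<And>i j. coeff (coeff p j) i = coeff (coeff q j) i) \<Longrightarrow> p = q"
  by (intro poly_eqI) auto

lemma homogeneous_iff:
  "homogeneous n p \<longleftrightarrow> (\<forall>i j. i + j \<noteq> n \<longrightarrow> coeff (coeff p j) i = 0)"
proof
  assume "homogeneous n p"
  then show "\<forall>i j. i + j \<noteq> n \<longrightarrow> coeff (coeff p j) i = 0"
    using coeff_hom_part[of n p] by metis
next
  assume "\<forall>i j. i + j \<noteq> n \<longrightarrow> coeff (coeff p j) i = 0"
  then show "homogeneous n p" by (intro poly_poly_eqI) (simp add: coeff_hom_part)
qed

lemma hom_part_0 [simp]: "hom_part n 0 = 0"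
  by (intro poly_poly_eqI) (simp add: coeff_hom_part)

lemma hom_part_add: "hom_part n (p + q) = hom_part n p + hom_part n q"
  by (intro poly_poly_eqI) (simp add: coeff_hom_part)

lemma hom_part_diff: "hom_part n (p - q) = hom_part n p - hom_part n q"
  by (intro poly_poly_eqI) (simp add: coeff_hom_part)

lemma hom_part_sum: "hom_part n (\<Sum>i\<in>I. f i) = (\<Sum>i\<in>I. hom_part n (f i))"
  by (induction I rule: infinite_finite_induct) (auto simp: hom_part_add)

lemma hom_part_hom_part:
  "hom_part n (hom_part m p) = (if m = n then hom_part m p else 0)"
  by (intro poly_poly_eqI) (simp add: coeff_hom_part)

lemma homogeneous_const: "homogeneous 0 (const a)"
  by (auto simp: homogeneous_iff coeff_pCons split: nat.split)

lemma homogeneous_X: "homogeneous 1 X_var"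
  by (auto simp: homogeneous_iff coeff_pCons split: nat.split)

lemma homogeneous_Y: "homogeneous 1 Y_var"
  by (auto simp: homogeneous_iff coeff_pCons split: nat.split)

lemma homogeneous_add: "homogeneous n p \<Longrightarrow> homogeneous n q \<Longrightarrow> homogeneous n (p + q)"
  by (simp add: hom_part_add)

lemma homogeneous_sum: "(\<And>i. i \<in> I \<Longrightarrow> homogeneous n (f i)) \<Longrightarrow> homogeneous n (\<Sum>i\<in>I. f i)"
  by (simp add: hom_part_sum)

lemma homogeneous_mult:
  assumes "homogeneous m p" "homogeneous n q"
  shows "homogeneous (m + n) (p * q)"
  unfolding homogeneous_iff
proof (intro allI impI)
  fix i j assume ij: "i + j \<noteq> m + n"
  have 0: "coeff (coeff p a) b * coeff (coeff q (j - a)) (i - b) = 0" if "a \<le> j" "b \<le> i" for a b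
  proof (cases "b + a = m")
    case True
    then have "(i - b) + (j - a) \<noteq> n" using ij that by auto
    then have "coeff (coeff q (j - a)) (i - b) = 0"
      using assms(2)[unfolded homogeneous_iff] by blast
    then show ?thesis by simp
  next
    case False
    then have "coeff (coeff p a) b = 0"
      using assms(1)[unfolded homogeneous_iff] by blast
    then show ?thesis by simp
  qed
  show "coeff (coeff (p * q) j) i = 0"
    unfolding coeff_mult coeff_sum using 0 by (intro sum.neutral ballI) auto
qed

lemma homogeneous_const_mult: "homogeneous n p \<Longrightarrow> homogeneous n (const a * p)"
  using homogeneous_mult[OF homogeneous_const] by fastforce

lemma homogeneous_power: "homogeneous m p \<Longrightarrow> homogeneous (k * m) (p ^ k)"
proof (induction k)
  case 0
  show ?case using homogeneous_const[of 1] by (simp add: one_pCons)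
next
  case (Suc k)
  then show ?case using homogeneous_mult[of m p "k * m" "p ^ k"] by simp
qed

lemma homogeneous_prod:
  "(\<And>i. i \<in> I \<Longrightarrow> homogeneous 1 (f i)) \<Longrightarrow> homogeneous (card I) (\<Prod>i\<in>I. f i)"
proof (induction I rule: infinite_finite_induct)
  case (insert i I)
  then show ?case using homogeneous_mult[of 1 "f i" "card I" "prod f I"] by simp
qed (use homogeneous_const[of 1] in \<open>simp_all add: one_pCons\<close>)

lemma ex_sum_hom_parts: "\<exists>N. p = (\<Sum>n\<le>N. hom_part n p)"
proof
  let ?N = "degree p + (\<Sum>j\<le>degree p. degree (coeff p j))"
  show "p = (\<Sum>n\<le>?N. hom_part n p)"
  proof (intro poly_poly_eqI)
    fix i j
    have "i + j \<le> ?N" if "coeff (coeff p j) i \<noteq> 0"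
    proof -
      have j: "j \<le> degree p" using that by (metis coeff_0 le_degree)
      have "i \<le> degree (coeff p j)" using that by (rule le_degree)
      also have "\<dots> \<le> (\<Sum>j\<le>degree p. degree (coeff p j))"
        using j by (intro member_le_sum) auto
      finally show ?thesis using j by simp
    qed
    then show "coeff (coeff p j) i = coeff (coeff (\<Sum>n\<le>?N. hom_part n p) j) i"
      by (auto simp: coeff_sum coeff_hom_part)
  qed
qed

lemma additive_eqI:
  fixes T T' :: "'a::comm_ring_1 poly poly \<Rightarrow> 'b::ab_group_add"
  assumes "\<And>p q. T (p + q) = T p + T q" "\<And>p q. T' (p + q) = T' p + T' q"
    and mon: "\<And>a i j. T (const a * X_var ^ i * Y_var ^ j) = T' (const a * X_var ^ i * Y_var ^ j)"
  shows "T p = T' p"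
proof -
  have 0: "T 0 = 0" "T' 0 = 0" using assms(1,2)[of 0 0] by auto
  have T: "T (\<Sum>i\<in>I. f i) = (\<Sum>i\<in>I. T (f i))" "T' (\<Sum>i\<in>I. f i) = (\<Sum>i\<in>I. T' (f i))"
    for I :: "nat set" and f
    by (induction I rule: infinite_finite_induct) (auto simp: 0 assms(1,2))
  have "T (hom_part n p) = T' (hom_part n p)" for n
    unfolding hom_part_def by (simp only: T mon)
  then have "T (\<Sum>n\<le>N. hom_part n p) = T' (\<Sum>n\<le>N. hom_part n p)" for N
    by (simp only: T)
  moreover obtain N where "p = (\<Sum>n\<le>N. hom_part n p)" using ex_sum_hom_parts by blast
  ultimately show ?thesis by metis
qed

text \<open>
  An additive map of degree \<open>m\<close> commutes with taking homogeneous components. This covers both the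
  multiplication by a form and a linear change of variables.
\<close>
lemma hom_part_additive:
  fixes T :: "'a::comm_ring_1 poly poly \<Rightarrow> 'b::comm_ring_1 poly poly"
  assumes add: "\<And>p q. T (p + q) = T p + T q"
    and deg: "\<And>k p. homogeneous k p \<Longrightarrow> homogeneous (m + k) (T p)"
  shows "hom_part (m + n) (T p) = T (hom_part n p)"
proof -
  have 0: "T 0 = 0" using add[of 0 0] by simp
  have T: "T (\<Sum>i\<in>I. f i) = (\<Sum>i\<in>I. T (f i))" for I :: "nat set" and f
    by (induction I rule: infinite_finite_induct) (auto simp: 0 add)
  obtain N where N: "p = (\<Sum>k\<le>N. hom_part k p)" using ex_sum_hom_parts by blast
  have *: "hom_part (m + n) (T (hom_part k p)) = T (hom_part n (hom_part k p))" for k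
  proof -
    have hom: "hom_part (m + k) (T (hom_part k p)) = T (hom_part k p)"
      using deg[of k "hom_part k p"] by (simp add: hom_part_hom_part)
    have "hom_part (m + n) (T (hom_part k p)) = (if k = n then T (hom_part k p) else 0)"
      using hom hom_part_hom_part[of "m + n" "m + k" "T (hom_part k p)"] by (cases "k = n") auto
    also have "\<dots> = T (hom_part n (hom_part k p))"
      by (simp add: hom_part_hom_part 0)
    finally show ?thesis .
  qed
  have "hom_part (m + n) (T p) = (\<Sum>k\<le>N. hom_part (m + n) (T (hom_part k p)))"
    by (subst N) (simp add: T hom_part_sum)
  also have "\<dots> = T (hom_part n (\<Sum>k\<le>N. hom_part k p))"
    by (simp only: * T hom_part_sum)
  finally show ?thesis using N by simp
qed

lemma hom_part_mult:
  assumes "homogeneous m p"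
  shows "hom_part (m + n) (p * q) = p * hom_part n q"
  by (rule hom_part_additive[of "\<lambda>q. p * q"])
    (rule distrib_left, rule homogeneous_mult[OF assms])

section \<open>The shear \<open>x \<mapsto> x + e y\<close>\<close>

definition linear_form :: "'a::comm_ring_1 \<Rightarrow> 'a poly poly" where
  "linear_form e = X_var + const e * Y_var"

lemma homogeneous_linear_form: "homogeneous 1 (linear_form e)"
  unfolding linear_form_def
  by (intro homogeneous_add homogeneous_X homogeneous_const_mult homogeneous_Y)

text \<open>The substitution \<open>x \<mapsto> x + e y\<close>, \<open>y \<mapsto> y\<close>, which is an \<open>A\<close>-algebra endomorphism.\<close>
definition shear :: "'a::comm_ring_1 \<Rightarrow> 'a poly poly \<Rightarrow> 'a poly poly" where
  "shear e p = poly (map_poly (\<lambda>q. poly (map_poly const q) (linear_form e)) p) Y_var"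

lemma comm_ring_hom_eval:
  assumes "comm_ring_hom h"
  shows "comm_ring_hom (\<lambda>p. poly (map_poly h p) x)"
proof -
  interpret h: comm_ring_hom h by fact
  interpret map_poly_comm_ring_hom h ..
  show ?thesis by unfold_locales (auto simp: hom_distribs)
qed

lemma comm_ring_hom_const: "comm_ring_hom (const :: 'a::comm_ring_1 \<Rightarrow> _)"
  by unfold_locales (auto simp: one_pCons)

lemma comm_ring_hom_shear: "comm_ring_hom (shear e)"
  unfolding shear_def by (intro comm_ring_hom_eval comm_ring_hom_const)

lemma shear_add: "shear e (p + q) = shear e p + shear e q"
  and shear_mult: "shear e (p * q) = shear e p * shear e q"
  and shear_0 [simp]: "shear e 0 = 0"
proof -
  interpret comm_ring_hom "shear e" by (rule comm_ring_hom_shear)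
  show "shear e (p + q) = shear e p + shear e q" "shear e (p * q) = shear e p * shear e q"
    "shear e 0 = 0" by (rule hom_add hom_mult hom_zero)+
qed

lemma shear_power: "shear e (p ^ n) = shear e p ^ n"
proof -
  interpret comm_ring_hom "shear e" by (rule comm_ring_hom_shear)
  show ?thesis by (rule hom_power)
qed

lemma shear_const [simp]: "shear e (const a) = const a"
  and shear_X [simp]: "shear e X_var = linear_form e"
  and shear_Y [simp]: "shear e Y_var = Y_var"
proof -
  interpret C: comm_ring_hom "const :: 'a \<Rightarrow> _" by (rule comm_ring_hom_const)
  interpret E: comm_ring_hom "\<lambda>q. poly (map_poly const q) (linear_form e)"
    by (intro comm_ring_hom_eval comm_ring_hom_const)
  show "shear e (const a) = const a" "shear e X_var = linear_form e" "shear e Y_var = Y_var"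
    by (simp_all add: shear_def hom_distribs)
qed
lemma shear_linear_form: "shear e (linear_form e') = linear_form (e + e')"
proof -
  have "shear e (linear_form e') = linear_form e + const e' * Y_var"
    unfolding linear_form_def[of e'] by (simp only: shear_add shear_mult shear_const shear_X shear_Y)
  also have "\<dots> = linear_form (e + e')" by (simp add: linear_form_def)
  finally show ?thesis .
qed

lemma shear_shear: "shear e (shear (- e) p) = p"
proof (rule additive_eqI[where T = "\<lambda>p. shear e (shear (- e) p)" and T' = "\<lambda>p. p"])
  fix a i j
  have "linear_form (0::'a) = X_var" by (simp add: linear_form_def)
  then show "shear e (shear (- e) (const a * X_var ^ i * Y_var ^ j)) = const a * X_var ^ i * Y_var ^ j"
    by (simp only: shear_mult shear_power shear_const shear_X shear_Y shear_linear_form)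
      simp
qed (simp_all only: shear_add)

lemma homogeneous_monomial:
  "homogeneous 1 l \<Longrightarrow> homogeneous (i + j) (l ^ i * Y_var ^ j)"
  using homogeneous_mult[OF homogeneous_power homogeneous_power[OF homogeneous_Y], of 1 l i j]
  by simp

lemma homogeneous_shear: "homogeneous n p \<Longrightarrow> homogeneous n (shear e p)"
proof -
  assume p: "homogeneous n p"
  interpret comm_ring_hom "shear e" by (rule comm_ring_hom_shear)
  have "shear e p = shear e (hom_part n p)" using p by simp
  also have "\<dots> = (\<Sum>j\<le>n. const (coeff (coeff p j) (n - j)) * (linear_form e ^ (n - j) * Y_var ^ j))"
    unfolding hom_part_def hom_sum
    by (simp only: shear_mult shear_power shear_const shear_X shear_Y mult.assoc)
  also have "homogeneous n \<dots>"
  proof (intro homogeneous_sum homogeneous_const_mult)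
    fix j assume "j \<in> {..n}"
    then show "homogeneous n (linear_form e ^ (n - j) * Y_var ^ j)"
      using homogeneous_monomial[OF homogeneous_linear_form, of "n - j" j e] by simp
  qed
  finally show ?thesis .
qed

lemma hom_part_shear: "hom_part n (shear e p) = shear e (hom_part n p)"
  using hom_part_additive[of "shear e" 0 n p] by (simp add: shear_add homogeneous_shear)

section \<open>Coordinate changes\<close>

text \<open>
  The shear of the variables combined with a permutation of the basis vectors: \<open>e\<^sub>m\<close> is sent
  to the basis vector with index \<open>\<rho>\<^sup>-\<^sup>1 m\<close>.
\<close>
definition coord_change :: "'a::comm_ring_1 \<Rightarrow> (nat \<Rightarrow> nat) \<Rightarrow> 'a fvec \<Rightarrow> 'a fvec" where
  "coord_change e \<rho> v = (\<lambda>i. shear e (v (\<rho> i)))"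

lemma coord_change_add: "coord_change e \<rho> (u + v) = coord_change e \<rho> u + coord_change e \<rho> v"
  by (simp add: coord_change_def fun_eq_iff shear_add)

lemma coord_change_smul: "coord_change e \<rho> (smul p v) = smul (shear e p) (coord_change e \<rho> v)"
  by (simp add: coord_change_def fun_eq_iff smul_def shear_mult)

lemma coord_change_ascale: "coord_change e \<rho> (ascale a v) = ascale a (coord_change e \<rho> v)"
  by (simp only: ascale_def coord_change_smul shear_const)

lemma coord_change_hcomp: "hcomp n (coord_change e \<rho> v) = coord_change e \<rho> (hcomp n v)"
  by (simp add: coord_change_def fun_eq_iff hcomp_def hom_part_shear)

lemma coord_change_0 [simp]: "coord_change e \<rho> 0 = 0"
  by (simp add: coord_change_def fun_eq_iff)

lemma coord_change_inverse:
  assumes "\<rho> permutes S"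
  shows "coord_change e \<rho> (coord_change (- e) (inv_into UNIV \<rho>) v) = v"
    and "coord_change (- e) (inv_into UNIV \<rho>) (coord_change e \<rho> v) = v"
  using permutes_inverses[OF assms] shear_shear[of e] shear_shear[of "- e"]
  by (simp_all add: coord_change_def fun_eq_iff)

lemma coord_change_F_mod:
  assumes "\<rho> permutes {..<r}" "v \<in> F_mod r"
  shows "coord_change e \<rho> v \<in> F_mod r"
proof -
  have "\<rho> m = m" if "m \<ge> r" for m
    using permutes_not_in[OF assms(1)] that by simp
  then show ?thesis using assms(2) by (simp add: F_mod_def coord_change_def)
qed

lemma coord_change_F_deg:
  assumes "\<rho> permutes {..<r}" "v \<in> F_deg r n"
  shows "coord_change e \<rho> v \<in> F_deg r n"
  using assms coord_change_F_mod by (auto simp: F_deg_def coord_change_hcomp)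

interpretation S: Modules.module "smul :: 'a::comm_ring_1 poly poly \<Rightarrow> _"
  by (rule module_smul)

interpretation A: Modules.module "ascale :: 'a::comm_ring_1 \<Rightarrow> _"
proof
  interpret comm_ring_hom "const :: 'a \<Rightarrow> _" by (rule comm_ring_hom_const)
  fix a b :: 'a and u v :: "'a fvec"
  show "ascale a (u + v) = ascale a u + ascale a v"
    unfolding ascale_def by (rule S.scale_right_distrib)
  show "ascale (a + b) v = ascale a v + ascale b v"
    unfolding ascale_def hom_add by (rule S.scale_left_distrib)
  show "ascale a (ascale b v) = ascale (a * b) v"
    unfolding ascale_def hom_mult by (rule S.scale_scale)
  show "ascale 1 v = v"
    unfolding ascale_def hom_one by (rule S.scale_one)
qed

lemma graded_submoduleD:
  assumes "graded_submodule r V"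
  shows "V \<subseteq> F_mod r" "0 \<in> V" "u \<in> V \<Longrightarrow> v \<in> V \<Longrightarrow> u + v \<in> V" "v \<in> V \<Longrightarrow> smul p v \<in> V"
    "v \<in> V \<Longrightarrow> hcomp n v \<in> V"
  using assms unfolding graded_submodule_def
  by (auto intro: S.subspace_0 S.subspace_add S.subspace_scale)

lemma graded_submodule_ascale:
  "graded_submodule r V \<Longrightarrow> A.subspace V"
  by (intro A.subspaceI) (auto simp: ascale_def graded_submoduleD)

lemma basis_over_image:
  assumes V: "A.subspace V" and inj: "\<And>v. T v \<in> T ` V \<longleftrightarrow> v \<in> V"
    and add: "\<And>u v. T (u + v) = T u + T v" and sc: "\<And>a v. T (ascale a v) = ascale a (T v)"
    and X: "T ` X = Y"
    and B: "basis_over ascale f X V b I"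
  shows "basis_over ascale f Y (T ` V) (\<lambda>i. T (b i)) I"
proof -
  have 0: "T 0 = 0" using add[of 0 0] by simp
  have diff: "T (u - v) = T u - T v" for u v
    using add[of "u - v" v] by (simp add: algebra_simps)
  have sum: "T (\<Sum>i\<in>I. ascale (c i) (b i)) = (\<Sum>i\<in>I. ascale (c i) (T (b i)))" for c
    by (induction I rule: infinite_finite_induct)
      (simp_all only: sum.infinite sum.empty sum.insert 0 add sc not_False_eq_True)
  have TV: "A.subspace (T ` V)"
  proof (rule A.subspaceI)
    show "0 \<in> T ` V" using A.subspace_0[OF V] 0 by force
    show "x + y \<in> T ` V" if "x \<in> T ` V" "y \<in> T ` V" for x y
      using that A.subspace_add[OF V] by (auto simp flip: add)
    show "ascale c x \<in> T ` V" if "x \<in> T ` V" for c x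
      using that A.subspace_scale[OF V] by (auto simp flip: sc)
  qed
  note B' = B[unfolded A.basis_over_iff[OF V]]
  show ?thesis
    unfolding A.basis_over_iff[OF TV]
  proof (intro conjI ballI allI impI)
    show "finite I" "(\<lambda>i. T (b i)) ` I \<subseteq> Y" using B' X by auto
    fix y assume "y \<in> Y"
    then obtain m where m: "m \<in> X" "y = T m" using X by blast
    obtain c N where c: "ascale (f ^ N) m - (\<Sum>i\<in>I. ascale (c i) (b i)) \<in> V"
      using B'[THEN conjunct2, THEN conjunct2, THEN conjunct1, rule_format, OF m(1)]
      by (elim exE)
    have "ascale (f ^ N) y - (\<Sum>i\<in>I. ascale (c i) (T (b i))) =
        T (ascale (f ^ N) m - (\<Sum>i\<in>I. ascale (c i) (b i)))"
      by (simp only: diff sc sum m(2))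
    from image_eqI[where f = T, OF this c]
    show "\<exists>c N. ascale (f ^ N) y - (\<Sum>i\<in>I. ascale (c i) (T (b i))) \<in> T ` V"
      by (intro exI)
  next
    fix c i assume c: "(\<Sum>i\<in>I. ascale (c i) (T (b i))) \<in> T ` V" and i: "i \<in> I"
    have "(\<Sum>i\<in>I. ascale (c i) (b i)) \<in> V" using c unfolding sum[symmetric] inj .
    then have "\<forall>i\<in>I. \<exists>N. f ^ N * c i = 0"
      by (rule B'[THEN conjunct2, THEN conjunct2, THEN conjunct2, THEN spec, THEN mp])
    then show "\<exists>N. f ^ N * c i = 0" using i by blast
  qed
qed

lemma coord_change_mem_image_iff:
  assumes "\<rho> permutes S"
  shows "coord_change e \<rho> v \<in> coord_change e \<rho> ` V \<longleftrightarrow> v \<in> V"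
proof
  assume "coord_change e \<rho> v \<in> coord_change e \<rho> ` V"
  then obtain w where w: "w \<in> V" "coord_change e \<rho> v = coord_change e \<rho> w" by blast
  have "v = coord_change (- e) (inv_into UNIV \<rho>) (coord_change e \<rho> v)"
    by (rule coord_change_inverse(2)[OF assms, symmetric])
  also have "\<dots> = w" unfolding w(2) by (rule coord_change_inverse(2)[OF assms])
  finally show "v \<in> V" using w(1) by simp
qed simp

lemma coord_change_image_F_deg:
  fixes e :: "'a::comm_ring_1"
  assumes "\<rho> permutes {..<r}"
  shows "coord_change e \<rho> ` F_deg r n = F_deg r n"
proof
  show "coord_change e \<rho> ` F_deg r n \<subseteq> F_deg r n"
    using coord_change_F_deg[OF assms] by blast
  show "F_deg r n \<subseteq> coord_change e \<rho> ` F_deg r n"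
  proof
    fix v :: "'a fvec" assume "v \<in> F_deg r n"
    then have "coord_change (- e) (inv_into UNIV \<rho>) v \<in> F_deg r n"
      using coord_change_F_deg[OF permutes_inv[OF assms]] by blast
    then show "v \<in> coord_change e \<rho> ` F_deg r n"
      using coord_change_inverse(1)[OF assms] by (metis image_eqI)
  qed
qed

lemma basis_over_coord_change:
  assumes "\<rho> permutes {..<r}" "A.subspace V"
    and "basis_over ascale f (F_deg r n) V b I"
  shows "basis_over ascale f (F_deg r n) (coord_change e \<rho> ` V) (\<lambda>i. coord_change e \<rho> (b i)) I"
  by (rule basis_over_image[OF assms(2) coord_change_mem_image_iff[OF assms(1)] coord_change_add
      coord_change_ascale coord_change_image_F_deg[OF assms(1)] assms(3)])

text \<open>
  A coordinate change is bijective, additive and semilinear with respect to the graded automorphism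
  \<open>shear e\<close> of \<open>S\<^sub>A\<close>, which is the identity on \<open>A\<close>. It therefore respects gradings, saturation
  and freeness over localizations of \<open>A\<close>.
\<close>
lemma Quot_points_coord_change:
  assumes \<rho>: "\<rho> permutes {..<r}" and V: "V \<in> Quot_points r d"
  shows "coord_change e \<rho> ` V \<in> Quot_points r d"
proof -
  let ?T = "coord_change e \<rho>" and ?T' = "coord_change (- e) (inv_into UNIV \<rho>)"
  note inv = coord_change_inverse[OF \<rho>, of e]
  have gr: "graded_submodule r V" and sat: "saturated r V"
    and lf: "\<And>n. n \<ge> d \<Longrightarrow> locally_free ascale d (F_deg r n) V"
    using V by (auto simp: Quot_points_def)
  note G = graded_submoduleD[OF gr]
  have smul: "smul p (?T v) = ?T (smul (shear (- e) p) v)" for p v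
    by (simp add: coord_change_smul shear_shear)
  have "graded_submodule r (?T ` V)"
    unfolding graded_submodule_def
  proof (intro conjI ballI allI)
    show "?T ` V \<subseteq> F_mod r" using G(1) coord_change_F_mod[OF \<rho>] by blast
    show "S.subspace (?T ` V)"
    proof (rule S.subspaceI)
      show "0 \<in> ?T ` V" using G(2) coord_change_0 by (metis image_eqI)
      show "x + y \<in> ?T ` V" if "x \<in> ?T ` V" "y \<in> ?T ` V" for x y
        using that G(3) by (auto simp flip: coord_change_add)
      show "smul c x \<in> ?T ` V" if "x \<in> ?T ` V" for c x
        using that G(4) by (auto simp: smul)
    qed
    show "hcomp n v \<in> ?T ` V" if "v \<in> ?T ` V" for v n
      using that G(5) by (auto simp: coord_change_hcomp)
  qed
  moreover have "saturated r (?T ` V)"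
    unfolding saturated_def
  proof (intro ballI impI)
    fix v assume v: "v \<in> F_mod r" and "\<exists>N. \<forall>p. hom_part N p = p \<longrightarrow> smul p v \<in> ?T ` V"
    then obtain N where N: "\<And>p. homogeneous N p \<Longrightarrow> smul p v \<in> ?T ` V" by blast
    have "smul p (?T' v) \<in> V" if "homogeneous N p" for p
    proof -
      have "smul (shear e p) v \<in> ?T ` V" using that by (intro N homogeneous_shear)
      moreover have "smul (shear e p) v = ?T (smul p (?T' v))"
        by (simp add: coord_change_smul inv)
      ultimately show ?thesis using coord_change_mem_image_iff[OF \<rho>] by metis
    qed
    moreover have "?T' v \<in> F_mod r"
      using coord_change_F_mod[OF permutes_inv[OF \<rho>]] v by blast
    ultimately have "?T' v \<in> V" using sat unfolding saturated_def by blast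
    then show "v \<in> ?T ` V" using inv by (metis image_eqI)
  qed
  moreover have "locally_free ascale d (F_deg r n) (?T ` V)" if "n \<ge> d" for n
    using lf[OF that] basis_over_coord_change[OF \<rho> graded_submodule_ascale[OF gr]]
    unfolding locally_free_def by meson
  ultimately show ?thesis by (auto simp: Quot_points_def)
qed

definition shear_mat :: "'k::field \<Rightarrow> 'k mat" where
  "shear_mat c = mat 2 2 (\<lambda>(i, j). if i = j then 1 else if i = 0 then c else 0)"

definition permutation_mat :: "nat \<Rightarrow> (nat \<Rightarrow> nat) \<Rightarrow> 'k::field mat" where
  "permutation_mat r \<rho> = mat r r (\<lambda>(i, j). if \<rho> i = j then 1 else 0)"

text \<open>Outside \<open>F\<^sub>A\<^sup>r\<close> the two sides need not agree, since \<open>gl_act\<close> discards the entries beyond \<open>r\<close>.\<close>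
lemma coord_change_eq_gl_act:
  fixes \<phi> :: "'k::field \<Rightarrow> 'a::comm_ring_1"
  assumes \<phi>: "comm_ring_hom \<phi>" and \<rho>: "\<rho> permutes {..<r}" and v: "v \<in> F_mod r"
  shows "gl_act \<phi> r (shear_mat c) (permutation_mat r \<rho>) v = coord_change (\<phi> c) \<rho> v"
proof
  interpret comm_ring_hom \<phi> by fact
  have cv: "change_vars \<phi> (shear_mat c) p = shear (\<phi> c) p" for p
    by (simp add: change_vars_def shear_def linear_form_def shear_mat_def one_pCons)
  fix i
  show "gl_act \<phi> r (shear_mat c) (permutation_mat r \<rho>) v i = coord_change (\<phi> c) \<rho> v i"
  proof (cases "i < r")
    case True
    have "(\<Sum>j<r. const (\<phi> (permutation_mat r \<rho> $$ (i, j))) *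
        change_vars \<phi> (shear_mat c) (v j)) = (\<Sum>j<r. if j = \<rho> i then shear (\<phi> c) (v j) else 0)"
      using True by (intro sum.cong) (auto simp: cv permutation_mat_def simp flip: one_pCons)
    also have "\<dots> = shear (\<phi> c) (v (\<rho> i))"
      using True permutes_in_image[OF \<rho>, of i] by simp
    finally show ?thesis using True by (simp add: gl_act_def coord_change_def)
  next
    case False
    then have "\<rho> i = i" "v i = 0" using permutes_not_in[OF \<rho>] v by (auto simp: F_mod_def)
    then show ?thesis using False by (simp add: gl_act_def coord_change_def)
  qed
qed

lemma shear_mat_GL: "shear_mat c \<in> GL 2"
proof -
  have "shear_mat c * shear_mat (- c) = 1\<^sub>m 2" for c :: 'a
    by (intro eq_matI) (auto simp: shear_mat_def scalar_prod_def numeral_2_eq_2 less_Suc_eq)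
  from this[of c] this[of "- c", unfolded minus_minus] have "invertible_mat (shear_mat c)"
    unfolding invertible_mat_def inverts_mat_def
    by (intro conjI exI[of _ "shear_mat (- c)"]) (simp_all add: shear_mat_def)
  then show ?thesis by (simp add: GL_def shear_mat_def)
qed
lemma permutation_mat_GL:
  assumes "\<rho> permutes {..<r}"
  shows "permutation_mat r \<rho> \<in> (GL r :: 'k::field mat set)"
proof -
  let ?h = "permutation_mat r :: _ \<Rightarrow> 'k mat"
  have *: "?h \<rho> * ?h (inv_into UNIV \<rho>) = 1\<^sub>m r" if \<rho>: "\<rho> permutes {..<r}" for \<rho>
  proof (intro eq_matI)
    fix i j assume "i < dim_row (1\<^sub>m r :: 'k mat)" "j < dim_col (1\<^sub>m r :: 'k mat)"
    then have ij: "i < r" "j < r" by auto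
    have "(?h \<rho> * ?h (inv_into UNIV \<rho>)) $$ (i, j) =
        (\<Sum>k<r. (if \<rho> i = k then 1 else 0) * (if inv_into UNIV \<rho> k = j then 1 else 0))"
      using ij by (simp add: permutation_mat_def scalar_prod_def atLeast0LessThan)
    also have "\<dots> = (\<Sum>k<r. (if k = \<rho> i then if inv_into UNIV \<rho> k = j then 1 else 0 else 0))"
      by (intro sum.cong) auto
    also have "\<dots> = (if i = j then 1 else 0)"
      using ij permutes_in_image[OF \<rho>, of i] permutes_inverses(2)[OF \<rho>] by simp
    finally show "(?h \<rho> * ?h (inv_into UNIV \<rho>)) $$ (i, j) = 1\<^sub>m r $$ (i, j)" using ij by simp
  qed (auto simp: permutation_mat_def)
  from *[OF assms] *[OF permutes_inv[OF assms]] have "invertible_mat (?h \<rho>)"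
    by (auto simp: invertible_mat_def inverts_mat_def permutes_inv_inv[OF assms]
        permutation_mat_def intro!: exI[of _ "?h (inv_into UNIV \<rho>)"])
  then show ?thesis by (simp add: GL_def permutation_mat_def)
qed
section \<open>The fibre of a point of the Quot scheme at a maximal ideal\<close>

text \<open>The element \<open>p e\<^sub>m\<close> of \<open>F\<^sub>A\<^sup>r\<close>.\<close>
definition vec_at :: "nat \<Rightarrow> 'a::comm_ring_1 poly poly \<Rightarrow> 'a fvec" where
  "vec_at m p = (\<lambda>l. if l = m then p else 0)"

lemma smul_vec_at: "smul q (vec_at m p) = vec_at m (q * p)"
  by (auto simp: smul_def vec_at_def)

lemma ascale_vec_at: "ascale a (vec_at m p) = vec_at m (const a * p)"
  unfolding ascale_def smul_vec_at ..

lemma vec_at_diff: "vec_at m (p - q) = vec_at m p - vec_at m q"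
  by (auto simp: vec_at_def fun_eq_iff)

lemma mon_elt_eq_vec_at: "mon_elt n (m, j) = vec_at m (X_var ^ (n - j) * Y_var ^ j)"
  by (simp add: mon_elt_def vec_at_def)

lemma coord_change_vec_at:
  assumes "\<rho> permutes S"
  shows "coord_change e \<rho> (vec_at m p) = vec_at (inv_into UNIV \<rho> m) (shear e p)"
proof
  fix i
  have "\<rho> i = m \<longleftrightarrow> i = inv_into UNIV \<rho> m"
    using permutes_inv_eq[OF assms] by metis
  then show "coord_change e \<rho> (vec_at m p) i = vec_at (inv_into UNIV \<rho> m) (shear e p) i"
    by (simp add: coord_change_def vec_at_def)
qed

lemma F_deg_iff: "v \<in> F_deg r n \<longleftrightarrow> (\<forall>m\<ge>r. v m = 0) \<and> (\<forall>m. homogeneous n (v m))"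
  by (auto simp: F_deg_def F_mod_def hcomp_def fun_eq_iff)

lemma vec_at_F_deg: "m < r \<Longrightarrow> homogeneous n p \<Longrightarrow> vec_at m p \<in> F_deg r n"
  by (auto simp: F_deg_iff vec_at_def)

lemma mon_elt_F_deg: "m < r \<Longrightarrow> j \<le> n \<Longrightarrow> mon_elt n (m, j) \<in> F_deg r n"
  unfolding mon_elt_eq_vec_at
  using homogeneous_monomial[OF homogeneous_X, of "n - j" j] by (intro vec_at_F_deg) auto

lemma smul_F_deg: "homogeneous m p \<Longrightarrow> v \<in> F_deg r n \<Longrightarrow> smul p v \<in> F_deg r (m + n)"
  by (auto simp: F_deg_iff smul_def intro: homogeneous_mult)

lemma subspace_F_deg: "A.subspace (F_deg r n)"
proof (rule A.subspaceI)
  show "0 \<in> F_deg r n" by (simp add: F_deg_iff)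
  show "x + y \<in> F_deg r n" if "x \<in> F_deg r n" "y \<in> F_deg r n" for x y
    using that by (simp add: F_deg_iff hom_part_add)
  show "ascale c x \<in> F_deg r n" if "x \<in> F_deg r n" for c x
    using smul_F_deg[OF homogeneous_const that] by (simp add: ascale_def)
qed

lemma sum_fvec_apply: "(\<Sum>i\<in>I. f i) l = (\<Sum>i\<in>I. f i l)" for f :: "'i \<Rightarrow> 'a::comm_ring_1 fvec"
  by (induction I rule: infinite_finite_induct) auto

lemma F_deg_expand:
  assumes "v \<in> F_deg r n"
  shows "v = (\<Sum>m<r. \<Sum>j\<le>n. ascale (coeff (coeff (v m) j) (n - j)) (mon_elt n (m, j)))"
    (is "_ = ?s")
proof
  fix l
  have "?s l = (\<Sum>m<r. if m = l then hom_part n (v m) else 0)"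
    unfolding sum_fvec_apply mon_elt_eq_vec_at ascale_vec_at hom_part_def
    by (intro sum.cong) (simp_all add: vec_at_def mult.assoc)
  also have "\<dots> = v l" using assms by (simp add: F_deg_iff)
  finally show "v l = ?s l" by simp
qed

lemma F_deg_generated:
  assumes "A.subspace Z" "\<And>m j. m < r \<Longrightarrow> j \<le> n \<Longrightarrow> mon_elt n (m, j) \<in> Z"
  shows "F_deg r n \<subseteq> Z"
proof
  fix v :: "'a fvec" assume "v \<in> F_deg r n"
  then have "v = (\<Sum>m<r. \<Sum>j\<le>n. ascale (coeff (coeff (v m) j) (n - j)) (mon_elt n (m, j)))"
    by (rule F_deg_expand)
  also have "\<dots> \<in> Z"
    using assms by (intro A.subspace_sum[OF assms(1)] A.subspace_scale[OF assms(1)]) auto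
  finally show "v \<in> Z" .
qed

lemma dvd_prod_diff:
  fixes l :: "'b::comm_ring_1"
  assumes "\<And>i. i \<in> I \<Longrightarrow> l dvd f i - g i"
  shows "l dvd prod f I - prod g I"
  using assms
proof (induction I rule: infinite_finite_induct)
  case (insert i I)
  have "f i * prod f I - g i * prod g I
      = prod f I * (f i - g i) + g i * (prod f I - prod g I)" by (simp add: algebra_simps)
  then show ?case using insert by (simp add: dvd_add)
qed auto

text \<open>Over a finite field, one plus the product of all \<open>X - a\<close> has no root.\<close>
lemma infinite_alg_closed_field: "infinite (UNIV :: 'k::alg_closed_field set)"
proof
  assume fin: "finite (UNIV :: 'k set)"
  define p :: "'k poly" where "p = (\<Prod>a\<in>UNIV. [:- a, 1:]) + 1"
  have "degree (\<Prod>a\<in>(UNIV :: 'k set). [:- a, 1:]) = card (UNIV :: 'k set)"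
    by (subst degree_prod_eq_sum_degree) auto
  then have "degree (\<Prod>a\<in>(UNIV :: 'k set). [:- a, 1:]) > 0" using fin by (simp add: finite_UNIV_card_ge_0)
  then have "degree p > 0" unfolding p_def by (subst degree_add_eq_left) auto
  then obtain x where "poly p x = 0" using alg_closed_imp_poly_has_root by blast
  moreover have "(\<Prod>a\<in>UNIV. x - a) = 0" using fin by (intro prod_zero) auto
  ultimately show False by (simp add: p_def poly_prod)
qed
locale quot_fibre = maximal_ideal \<mm> for \<mm> :: "'a::comm_ring_1 set" +
  fixes r d :: nat and V :: "'a fvec set"
  assumes V: "V \<in> Quot_points r d"
begin

lemma graded_V: "graded_submodule r V"
  using V by (simp add: Quot_points_def)

definition \<mm>F :: "'a fvec set" where
  "\<mm>F = {v. \<forall>l j i. coeff (coeff (v l) j) i \<in> \<mm>}"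

text \<open>
  The preimage of the zero of the fibre of \<open>F\<^sub>A\<^sup>r / V\<close>. The functions in \<open>\<mm>F\<close> may have arbitrary
  support, so that multiples by \<open>\<mm>\<close> lie in \<open>W\<close> for every element of the type.
\<close>
definition W :: "'a fvec set" where
  "W = {w. \<exists>v\<in>V. w - v \<in> \<mm>F}"

lemma smul_\<mm>F: "v \<in> \<mm>F \<Longrightarrow> smul p v \<in> \<mm>F"
  by (auto simp: \<mm>F_def smul_def coeff_mult coeff_sum intro!: sum_mem mult_mem)

lemma zero_\<mm>F: "0 \<in> \<mm>F"
  by (simp add: \<mm>F_def)

lemma add_\<mm>F: "u \<in> \<mm>F \<Longrightarrow> v \<in> \<mm>F \<Longrightarrow> u + v \<in> \<mm>F"
  by (simp add: \<mm>F_def add_mem)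

lemma smul_W: "w \<in> W \<Longrightarrow> smul p w \<in> W"
proof -
  assume "w \<in> W"
  then obtain v where v: "v \<in> V" "w - v \<in> \<mm>F" by (auto simp: W_def)
  have "smul p w - smul p v \<in> \<mm>F"
    using smul_\<mm>F[OF v(2)] by (simp add: S.scale_right_diff_distrib)
  then show "smul p w \<in> W" unfolding W_def using graded_submoduleD(4)[OF graded_V v(1)] by blast
qed

sublocale residue_module ascale \<mm> V W
proof
  show "A.subspace V" by (rule graded_submodule_ascale[OF graded_V])
  show "V \<subseteq> W" unfolding W_def using zero_\<mm>F by force
  show "A.subspace W"
  proof (rule A.subspaceI)
    show "0 \<in> W" using \<open>V \<subseteq> W\<close> graded_submoduleD(2)[OF graded_V] by blast
    show "ascale c x \<in> W" if "x \<in> W" for c x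
      unfolding ascale_def using that by (rule smul_W)
    fix x y assume "x \<in> W" "y \<in> W"
    then obtain u v where uv: "u \<in> V" "x - u \<in> \<mm>F" "v \<in> V" "y - v \<in> \<mm>F" by (auto simp: W_def)
    have "(x + y) - (u + v) = (x - u) + (y - v)" by simp
    then have "(x + y) - (u + v) \<in> \<mm>F" using add_\<mm>F[OF uv(2,4)] by metis
    then show "x + y \<in> W" unfolding W_def using graded_submoduleD(3)[OF graded_V uv(1,3)] by blast
  qed
  fix a v assume "a \<in> \<mm>"
  then have "ascale a v - 0 \<in> \<mm>F" by (simp add: \<mm>F_def ascale_def smul_def mult_mem2)
  then show "ascale a v \<in> W" unfolding W_def using graded_submoduleD(2)[OF graded_V] by blast
qed

text \<open>
  \<open>V\<close> being graded, an element of \<open>V\<close> congruent to \<open>w\<close> may be replaced by its component of degree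
  \<open>n\<close>; the difference is then a combination of monomials with coefficients in \<open>\<mm>\<close>.
\<close>
lemma F_deg_inter_W:
  assumes "w \<in> F_deg r n" "w \<in> W"
  shows "\<exists>v\<in>V. w - v \<in> A.span {ascale a x | a x. a \<in> \<mm> \<and> x \<in> F_deg r n}"
proof -
  obtain v where v: "v \<in> V" "w - v \<in> \<mm>F" using assms(2) by (auto simp: W_def)
  let ?v = "hcomp n v"
  have v': "?v \<in> V" using graded_submoduleD(5)[OF graded_V v(1)] .
  have "?v \<in> F_mod r" using v' graded_submoduleD(1)[OF graded_V] by blast
  then have "?v \<in> F_deg r n"
    by (auto simp: F_deg_def hcomp_def hom_part_hom_part)
  then have wv: "w - ?v \<in> F_deg r n" using assms(1) subspace_F_deg A.subspace_diff by blast
  have "w - ?v = hcomp n (w - v)"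
    using assms(1) by (auto simp: F_deg_iff hcomp_def hom_part_diff fun_eq_iff)
  then have mF: "w - ?v \<in> \<mm>F" using v(2) by (auto simp: \<mm>F_def hcomp_def coeff_hom_part)
  have "w - ?v = (\<Sum>m<r. \<Sum>j\<le>n. ascale (coeff (coeff ((w - ?v) m) j) (n - j)) (mon_elt n (m, j)))"
    using wv by (rule F_deg_expand)
  also have "\<dots> \<in> A.span {ascale a x | a x. a \<in> \<mm> \<and> x \<in> F_deg r n}"
  proof (intro A.span_sum A.span_base)
    fix m j assume mj: "m \<in> {..<r}" "j \<in> {..n}"
    have "coeff (coeff ((w - ?v) m) j) (n - j) \<in> \<mm>" using mF unfolding \<mm>F_def by blast
    moreover have "mon_elt n (m, j) \<in> F_deg r n" using mj mon_elt_F_deg by auto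
    ultimately show "ascale (coeff (coeff ((w - ?v) m) j) (n - j)) (mon_elt n (m, j))
        \<in> {ascale a x | a x. a \<in> \<mm> \<and> x \<in> F_deg r n}"
      by blast
  qed
  finally show ?thesis using v' by blast
qed

lemma free_at_F_deg:
  assumes "n \<ge> d"
  obtains g b where "free_at d (F_deg r n) g b"
proof -
  have "locally_free ascale d (F_deg r n) V" using V assms by (simp add: Quot_points_def)
  then obtain G c where G: "(\<Sum>g\<in>G. c g * g) = 1"
    "\<And>g. g \<in> G \<Longrightarrow> \<exists>b. basis_over ascale g (F_deg r n) V b {..<d}"
    unfolding locally_free_def by blast
  have "\<exists>g\<in>G. g \<notin> \<mm>"
  proof (rule ccontr)
    assume "\<not> (\<exists>g\<in>G. g \<notin> \<mm>)"
    then have "(\<Sum>g\<in>G. c g * g) \<in> \<mm>" by (intro sum_mem mult_mem) auto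
    then show False using G(1) proper by simp
  qed
  then obtain g b where "g \<notin> \<mm>" "basis_over ascale g (F_deg r n) V b {..<d}" using G(2) by blast
  then show ?thesis using that[of g b] F_deg_inter_W subspace_F_deg by (auto simp: free_at_def)
qed

lemma card_indep_le_d:
  assumes "n \<ge> d" "finite S" "indep S" "S \<subseteq> F_deg r n"
  shows "card S \<le> d"
  by (rule free_at_F_deg[OF assms(1)]) (rule card_indep_le_rank[OF _ assms(2-)])

lemma d_le_card_generators:
  assumes "n \<ge> d" "finite T" "F_deg r n \<subseteq> cl T"
  shows "d \<le> card T"
  by (rule free_at_F_deg[OF assms(1)]) (rule rank_le_card_generators[OF _ assms(2-)])

section \<open>A linear form that acts injectively on the fibre\<close>

text \<open>
  The fibres in degrees \<open>d\<close> and \<open>d + 1\<close> both have dimension \<open>d\<close>. Completing \<open>v\<close> to a basis in degree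
  \<open>d\<close> by a set \<open>U\<close> of \<open>d - 1\<close> elements shows that the image of \<open>l\<close> is spanned by \<open>l U\<close>, which
  is too small.
\<close>
lemma not_surjective_if_not_injective:
  assumes l: "homogeneous 1 l" and v: "v \<in> F_deg r d" "v \<notin> W" "smul l v \<in> W"
  shows "\<not> F_deg r (Suc d) \<subseteq> cl (smul l ` F_deg r d)"
proof
  assume sur: "F_deg r (Suc d) \<subseteq> cl (smul l ` F_deg r d)"
  obtain g b where F: "free_at d (F_deg r d) g b" using free_at_F_deg[OF order_refl] .
  let ?T = "b ` {..<d}"
  have "indep {v}" using v(2) by (simp add: indep_def)
  moreover have "{v} \<subseteq> cl ?T" using v(1) free_at_generates[OF F] by blast
  ultimately obtain U where U: "U \<subseteq> ?T" "card U + card {v} = card ?T" "?T \<subseteq> cl ({v} \<union> U)"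
    using Steinitz[of "{v}" ?T] by auto
  have finU: "finite U" using U(1) by (rule finite_subset) simp
  let ?Z = "{x. smul l x \<in> cl (smul l ` U)}"
  have "A.subspace ?Z"
  proof (rule A.subspaceI)
    show "0 \<in> ?Z" using A.subspace_0[OF subspace_cl] by simp
    show "x + y \<in> ?Z" if "x \<in> ?Z" "y \<in> ?Z" for x y
      using that A.subspace_add[OF subspace_cl] by (simp add: S.scale_right_distrib)
    show "ascale c x \<in> ?Z" if "x \<in> ?Z" for c x
    proof -
      have "smul l (ascale c x) = ascale c (smul l x)"
        by (simp add: ascale_def S.scale_left_commute)
      then show ?thesis using that A.subspace_scale[OF subspace_cl] by simp
    qed
  qed
  moreover have "{v} \<union> U \<subseteq> ?Z" using v(3) W_subset_cl subset_cl[of "smul l ` U"] by auto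
  moreover have "W \<subseteq> ?Z" using smul_W W_subset_cl by blast
  ultimately have "cl ({v} \<union> U) \<subseteq> ?Z" by (intro cl_minimal)
  then have "F_deg r d \<subseteq> ?Z"
    using free_at_generates[OF F] cl_least[OF U(3)] by blast
  then have "smul l ` F_deg r d \<subseteq> cl (smul l ` U)" by blast
  then have "F_deg r (Suc d) \<subseteq> cl (smul l ` U)" using sur cl_least by blast
  then have "d \<le> card (smul l ` U)" using finU by (intro d_le_card_generators[of "Suc d"]) auto
  also have "\<dots> \<le> card U" using finU by (rule card_image_le)
  also have "\<dots> < card ?T" using U(2) by simp
  also have "\<dots> \<le> d" using card_image_le[of "{..<d}" b] by simp
  finally show False by simp
qed

text \<open>The cofactor of \<open>l\<close> in a form may be taken to be a form.\<close>
lemma vec_at_dvd_mem: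
  assumes "homogeneous 1 l" "l dvd q" "homogeneous (Suc n) q" "m < r"
  shows "vec_at m q \<in> smul l ` F_deg r n"
proof -
  obtain s where s: "q = l * s" using assms(2) by blast
  have "q = hom_part (1 + n) q" using assms(3) by simp
  also have "\<dots> = l * hom_part n s" unfolding s by (rule hom_part_mult[OF assms(1)])
  finally have "vec_at m q = smul l (vec_at m (hom_part n s))" by (simp add: smul_vec_at)
  moreover have "vec_at m (hom_part n s) \<in> F_deg r n"
    using assms(4) by (intro vec_at_F_deg) (auto simp: hom_part_hom_part)
  ultimately show ?thesis by blast
qed

text \<open>
  Modulo \<open>l = x + e y\<close> every form of degree \<open>n + 1\<close> is a multiple of \<open>y\<^sup>n\<^sup>+\<^sup>1\<close>. If \<open>q\<close> is a unit
  multiple of it, the elements \<open>q e\<^sub>m\<close> thus generate everything in degree \<open>n + 1\<close> modulo the image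
  of \<open>l\<close>.
\<close>
lemma surjective_if_unit_residue:
  assumes l: "l = linear_form e" and q: "homogeneous (Suc n) q"
    and unit: "l dvd q - const a * Y_var ^ Suc n" "b * a = 1"
    and mem: "\<And>m. m < r \<Longrightarrow> vec_at m q \<in> cl (smul l ` F_deg r n)"
  shows "F_deg r (Suc n) \<subseteq> cl (smul l ` F_deg r n)" (is "_ \<subseteq> ?C")
proof (rule F_deg_generated[OF subspace_cl])
  interpret C: comm_ring_hom "const :: 'a \<Rightarrow> _" by (rule comm_ring_hom_const)
  note hl = homogeneous_linear_form[of e, folded l]
  fix m j assume mj: "m < r" "j \<le> Suc n"
  have dvd_mem: "vec_at m p \<in> ?C" if "l dvd p" "homogeneous (Suc n) p" for p
    using subsetD[OF subset_cl vec_at_dvd_mem[OF hl that mj(1)]] .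
  have hY: "homogeneous (Suc n) (const c * Y_var ^ Suc n)" for c :: 'a
    using homogeneous_power[OF homogeneous_Y, of "Suc n"]
    by (intro homogeneous_const_mult) simp
  have "vec_at m (q - const a * Y_var ^ Suc n) \<in> ?C"
    using unit(1) by (intro dvd_mem) (simp_all only: hom_part_diff q hY)
  then have "vec_at m q - vec_at m (q - const a * Y_var ^ Suc n) \<in> ?C"
    using mem[OF mj(1)] A.subspace_diff[OF subspace_cl] by blast
  then have "vec_at m (const a * Y_var ^ Suc n) \<in> ?C"
    unfolding vec_at_diff by (simp only: diff_diff_eq2 add_diff_cancel_left')
  then have "ascale b (vec_at m (const a * Y_var ^ Suc n)) \<in> ?C"
    by (rule A.subspace_scale[OF subspace_cl])
  also have "ascale b (vec_at m (const a * Y_var ^ Suc n)) = vec_at m (const (b * a) * Y_var ^ Suc n)"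
    unfolding ascale_vec_at C.hom_mult by (simp only: mult.assoc)
  finally have Y: "vec_at m (Y_var ^ Suc n) \<in> ?C" unfolding unit(2) C.hom_one by simp
  let ?p = "X_var ^ (Suc n - j) * Y_var ^ j" and ?c = "(- e) ^ (Suc n - j)"
  have dvd: "l dvd ?p - const ?c * Y_var ^ Suc n"
  proof -
    have "X_var - const (- e) * Y_var = l" unfolding l linear_form_def C.hom_uminus by simp
    then have "l dvd X_var ^ (Suc n - j) - (const (- e) * Y_var) ^ (Suc n - j)"
      using power_diff_sumr2[of X_var "Suc n - j" "const (- e) * Y_var"] by simp
    then have "l dvd (X_var ^ (Suc n - j) - (const (- e) * Y_var) ^ (Suc n - j)) * Y_var ^ j"
      by (rule dvd_mult2)
    moreover have "(Y_var :: 'a poly poly) ^ Suc n = Y_var ^ (Suc n - j) * Y_var ^ j"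
      using mj(2) by (simp only: power_add[symmetric] le_add_diff_inverse2)
    then have "(X_var ^ (Suc n - j) - (const (- e) * Y_var) ^ (Suc n - j)) * Y_var ^ j =
        ?p - const ?c * Y_var ^ Suc n"
      by (simp only: left_diff_distrib power_mult_distrib C.hom_power mult.assoc)
    ultimately show ?thesis by metis
  qed
  have hp: "homogeneous (Suc n) ?p"
    using homogeneous_monomial[OF homogeneous_X, of "Suc n - j" j] mj(2) by simp
  have "vec_at m (?p - const ?c * Y_var ^ Suc n) \<in> ?C"
    using dvd by (intro dvd_mem) (simp_all only: hom_part_diff hY hp)
  moreover have "ascale ?c (vec_at m (Y_var ^ Suc n)) \<in> ?C"
    using Y by (rule A.subspace_scale[OF subspace_cl])
  ultimately have "vec_at m (?p - const ?c * Y_var ^ Suc n) + ascale ?c (vec_at m (Y_var ^ Suc n)) \<in> ?C"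
    by (rule A.subspace_add[OF subspace_cl])
  then show "mon_elt (Suc n) (m, j) \<in> ?C"
    unfolding mon_elt_eq_vec_at ascale_vec_at vec_at_diff by (simp only: diff_add_cancel)
qed

text \<open>
  Suppose that \<open>l\<^sub>c = x + c y\<close> fails to be injective for all \<open>c\<close> in a set \<open>C\<close> of \<open>d + 1\<close> scalars.
  Then it fails to be surjective, and the form \<open>q\<^sub>c = y \<Prod> l\<^bsub>c'\<^esub>\<close>, with \<open>c'\<close> running through
  \<open>C - {c}\<close>, is a unit times \<open>y\<^sup>d\<^sup>+\<^sup>1\<close> modulo \<open>l\<^sub>c\<close>. So \<open>q\<^sub>c e\<^sub>m\<close> is not in the image of \<open>l\<^sub>c\<close> for some
  \<open>m\<close>, whereas every other \<open>q\<^bsub>c'\<^esub> e\<^bsub>m'\<^esub>\<close> is. This makes the \<open>d + 1\<close> chosen elements independent in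
  a space of dimension \<open>d\<close>.
\<close>
lemma exists_injective_linear_form:
  fixes \<phi> :: "'k::alg_closed_field \<Rightarrow> 'a"
  assumes \<phi>: "comm_ring_hom \<phi>"
  shows "\<exists>c. \<forall>v\<in>F_deg r d. smul (linear_form (\<phi> c)) v \<in> W \<longrightarrow> v \<in> W"
proof (rule ccontr)
  assume neg: "\<not> ?thesis"
  interpret \<phi>: comm_ring_hom \<phi> by fact
  interpret C: comm_ring_hom "const :: 'a \<Rightarrow> _" by (rule comm_ring_hom_const)
  define l where "l c = linear_form (\<phi> c)" for c
  have hl: "homogeneous 1 (l c)" for c unfolding l_def by (rule homogeneous_linear_form)
  obtain C :: "'k set" where C: "finite C" "card C = Suc d"
    using infinite_arbitrarily_large[OF infinite_alg_closed_field] by blast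
  define q where "q c = (\<Prod>c'\<in>C - {c}. l c') * Y_var" for c
  have hq: "homogeneous (Suc d) (q c)" if "c \<in> C" for c
  proof -
    have "card (C - {c}) = d" using that C by simp
    then have "homogeneous d (\<Prod>c'\<in>C - {c}. l c')"
      using homogeneous_prod[of "C - {c}" l] hl by simp
    from homogeneous_mult[OF this homogeneous_Y] show ?thesis by (simp add: q_def)
  qed
  have "\<exists>m<r. vec_at m (q c) \<notin> cl (smul (l c) ` F_deg r d)" if c: "c \<in> C" for c
  proof (rule ccontr)
    assume "\<not> (\<exists>m<r. vec_at m (q c) \<notin> cl (smul (l c) ` F_deg r d))"
    then have mem: "\<And>m. m < r \<Longrightarrow> vec_at m (q c) \<in> cl (smul (l c) ` F_deg r d)" by blast
    let ?a = "\<Prod>c'\<in>C - {c}. c' - c"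
    have "l c dvd l c' - const (\<phi> (c' - c)) * Y_var" for c'
    proof -
      have "l c' - const (\<phi> (c' - c)) * Y_var = l c"
        unfolding l_def linear_form_def \<phi>.hom_minus C.hom_minus by (simp only: left_diff_distrib) simp
      then show ?thesis by simp
    qed
    then have "l c dvd (\<Prod>c'\<in>C - {c}. l c') - (\<Prod>c'\<in>C - {c}. const (\<phi> (c' - c)) * Y_var)"
      by (intro dvd_prod_diff)
    also have "(\<Prod>c'\<in>C - {c}. const (\<phi> (c' - c)) * Y_var) = const (\<phi> ?a) * Y_var ^ d"
      using c C by (simp only: prod.distrib prod_constant card_Diff_singleton \<phi>.hom_prod C.hom_prod)
        simp
    finally have "l c dvd ((\<Prod>c'\<in>C - {c}. l c') - const (\<phi> ?a) * Y_var ^ d) * Y_var"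
      by (rule dvd_mult2)
    then have dvd: "l c dvd q c - const (\<phi> ?a) * Y_var ^ Suc d"
      by (simp only: q_def left_diff_distrib power_Suc2 mult.assoc)
    have unit: "\<phi> (inverse ?a) * \<phi> ?a = 1"
    proof -
      have "?a \<noteq> 0" using C(1) by simp
      then have "inverse ?a * ?a = 1" by simp
      then show ?thesis by (simp only: \<phi>.hom_mult[symmetric] \<phi>.hom_one)
    qed
    have sur: "F_deg r (Suc d) \<subseteq> cl (smul (l c) ` F_deg r d)"
      by (rule surjective_if_unit_residue[OF l_def hq[OF c] dvd unit mem])
    obtain v where "v \<in> F_deg r d" "v \<notin> W" "smul (l c) v \<in> W"
      using neg unfolding l_def by blast
    from not_surjective_if_not_injective[OF hl this] show False using sur by contradiction
  qed
  then obtain m where m: "\<And>c. c \<in> C \<Longrightarrow> m c < r"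
    "\<And>c. c \<in> C \<Longrightarrow> vec_at (m c) (q c) \<notin> cl (smul (l c) ` F_deg r d)" by metis
  define w where "w c = vec_at (m c) (q c)" for c
  have w: "w c \<notin> cl (w ` (C - {c}))" if c: "c \<in> C" for c
  proof -
    have "w ` (C - {c}) \<subseteq> smul (l c) ` F_deg r d"
    proof
      fix x assume "x \<in> w ` (C - {c})"
      then obtain c' where c': "c' \<in> C" "c' \<noteq> c" "x = w c'" by blast
      have "l c dvd q c'" unfolding q_def using c c' C(1) by (intro dvd_mult2 dvd_prodI) auto
      then show "x \<in> smul (l c) ` F_deg r d"
        unfolding c'(3) w_def using vec_at_dvd_mem[OF hl _ hq[OF c'(1)] m(1)[OF c'(1)]] by blast
    qed
    from cl_mono[OF this] show ?thesis using m(2)[OF c] unfolding w_def by (meson subsetD)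
  qed
  have "w ` C \<subseteq> F_deg r (Suc d)"
    unfolding w_def using m(1) hq vec_at_F_deg by blast
  then have "card (w ` C) \<le> d"
    using C(1) indep_family(2)[OF w] by (intro card_indep_le_d[of "Suc d"]) auto
  then show False using card_image[OF indep_family(1)[OF w]] C(2) by simp
qed

end

section \<open>The staircase basis\<close>

locale quot_fibre_form = quot_fibre +
  fixes e :: 'a
  assumes cancel: "v \<in> F_deg r d \<Longrightarrow> smul (linear_form e) v \<in> W \<Longrightarrow> v \<in> W"
begin

definition u :: "nat \<Rightarrow> nat \<Rightarrow> 'a fvec" where
  "u m j = vec_at m (linear_form e ^ (d - j) * Y_var ^ j)"

lemma u_F_deg: "m < r \<Longrightarrow> j \<le> d \<Longrightarrow> u m j \<in> F_deg r d"
  unfolding u_def using homogeneous_monomial[OF homogeneous_linear_form, of "d - j" j]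
  by (intro vec_at_F_deg) auto

lemma Y_smul_u:
  assumes "j < d"
  shows "smul Y_var (u m j) = smul (linear_form e) (u m (Suc j))"
proof -
  have "d - j = Suc (d - Suc j)" using assms by simp
  then have "Y_var * (linear_form e ^ (d - j) * Y_var ^ j) =
      linear_form e * (linear_form e ^ (d - Suc j) * Y_var ^ Suc j)"
    by (simp only: power_Suc mult_ac)
  then show ?thesis by (simp only: u_def smul_vec_at)
qed

text \<open>
  The elements \<open>x\<close> for which \<open>y x\<close> equals \<open>l x'\<close> in the fibre, with \<open>x'\<close> in the span of the shifted family,
  form a subspace. It contains \<open>u m j\<close> for \<open>(m, j) \<in> I\<close> because \<open>j < d\<close> leaves a factor \<open>l\<close> to spare,
  hence all their combinations. If such a combination is \<open>u m j\<close>, then \<open>y x = l (u m (j + 1))\<close>, and \<open>l\<close> may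
  be cancelled.
\<close>
lemma shift:
  assumes I: "I \<subseteq> {..<r} \<times> {..<d}" and m: "m < r" "j < d"
    and mem: "u m j \<in> cl (case_prod u ` I)"
  shows "u m (Suc j) \<in> cl ((\<lambda>(m, j). u m (Suc j)) ` I)"
proof -
  let ?I' = "(\<lambda>(m, j). u m (Suc j)) ` I" and ?l = "linear_form e"
  let ?Z = "{x. \<exists>x'\<in>A.span ?I'. smul Y_var x - smul ?l x' \<in> W}"
  have "A.subspace ?Z"
  proof (rule A.subspaceI)
    show "0 \<in> ?Z"
      using A.span_zero A.subspace_0[OF subspace_W] by (intro CollectI bexI[of _ 0]) simp_all
  next
    fix x y assume "x \<in> ?Z" "y \<in> ?Z"
    then obtain x' y' where xy: "x' \<in> A.span ?I'" "smul Y_var x - smul ?l x' \<in> W"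
      "y' \<in> A.span ?I'" "smul Y_var y - smul ?l y' \<in> W" by blast
    have "smul Y_var (x + y) - smul ?l (x' + y') =
        (smul Y_var x - smul ?l x') + (smul Y_var y - smul ?l y')"
      by (simp only: S.scale_right_distrib add_diff_add)
    also have "\<dots> \<in> W" using xy(2,4) by (rule A.subspace_add[OF subspace_W])
    finally show "x + y \<in> ?Z" using A.span_add[OF xy(1,3)] by blast
  next
    fix c x assume "x \<in> ?Z"
    then obtain x' where x: "x' \<in> A.span ?I'" "smul Y_var x - smul ?l x' \<in> W" by blast
    have "smul Y_var (ascale c x) - smul ?l (ascale c x') = ascale c (smul Y_var x - smul ?l x')"
      unfolding ascale_def S.scale_right_diff_distrib
      by (simp only: S.scale_left_commute[of "const c"])
    also have "\<dots> \<in> W" using x(2) by (rule A.subspace_scale[OF subspace_W])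
    finally show "ascale c x \<in> ?Z" using A.span_scale[OF x(1)] by blast
  qed
  moreover have "W \<subseteq> ?Z"
  proof
    fix w assume "w \<in> W"
    then have "smul Y_var w - smul ?l 0 \<in> W" using smul_W by simp
    then show "w \<in> ?Z" using A.span_zero by blast
  qed
  moreover have "case_prod u ` I \<subseteq> ?Z"
  proof
    fix x assume "x \<in> case_prod u ` I"
    then obtain m j where mj: "(m, j) \<in> I" "x = u m j" by auto
    then have "u m (Suc j) \<in> A.span ?I'" by (intro A.span_base) force
    moreover have "smul Y_var x - smul ?l (u m (Suc j)) \<in> W"
      using I mj Y_smul_u[of j m] A.subspace_0[OF subspace_W] by auto
    ultimately show "x \<in> ?Z" by blast
  qed
  ultimately have "cl (case_prod u ` I) \<subseteq> ?Z" by (intro cl_minimal)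
  then obtain x' where x': "x' \<in> A.span ?I'" "smul Y_var (u m j) - smul ?l x' \<in> W"
    using mem by blast
  have "?I' \<subseteq> F_deg r d"
  proof
    fix x assume "x \<in> ?I'"
    then obtain m j where "(m, j) \<in> I" "x = u m (Suc j)" by auto
    then show "x \<in> F_deg r d" using I by (auto intro!: u_F_deg)
  qed
  then have "A.span ?I' \<subseteq> F_deg r d" using subspace_F_deg by (rule A.span_minimal)
  then have "u m (Suc j) - x' \<in> F_deg r d"
    using x'(1) u_F_deg[of m "Suc j"] m A.subspace_diff[OF subspace_F_deg] by (meson Suc_leI subsetD)
  moreover have "smul ?l (u m (Suc j) - x') \<in> W"
    using x'(2) Y_smul_u[OF m(2)] by (simp only: S.scale_right_diff_distrib)
  ultimately have "u m (Suc j) - x' \<in> W" by (rule cancel)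
  then have "u m (Suc j) - x' \<in> cl ?I'" by (rule subsetD[OF W_subset_cl])
  moreover have "x' \<in> cl ?I'"
    using subsetD[OF A.span_minimal[OF subset_cl subspace_cl] x'(1)] .
  ultimately have "u m (Suc j) - x' + x' \<in> cl ?I'" by (rule A.subspace_add[OF subspace_cl])
  then show ?thesis by (simp only: diff_add_cancel)
qed

text \<open>
  With \<open>B\<close> spanning a subspace stable under \<open>y / l\<close>, this is the dimension of the cyclic
  submodule that \<open>e\<^sub>m\<close> generates under \<open>y / l\<close> modulo that subspace.
\<close>
definition height :: "'a fvec set \<Rightarrow> nat \<Rightarrow> nat" where
  "height B m = (LEAST i. u m i \<in> cl (B \<union> u m ` {..<i}))"

text \<open>The minimum exists and is at most \<open>d\<close>, as there are only \<open>d\<close> dimensions.\<close>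
lemma height:
  assumes B: "finite B" "indep B" "B \<subseteq> F_deg r d" and m: "m < r"
  shows "u m (height B m) \<in> cl (B \<union> u m ` {..<height B m})" (is ?mem)
    and "indep (B \<union> u m ` {..<height B m})" (is ?ind)
    and "card (B \<union> u m ` {..<height B m}) = card B + height B m" (is ?card)
    and "height B m \<le> d" (is ?le)
proof -
  have uF: "B \<union> u m ` {..<i} \<subseteq> F_deg r d" if "i \<le> Suc d" for i
    using B(3) u_F_deg[OF m] that by auto
  have fin: "finite (B \<union> u m ` {..<i})" for i using B(1) by simp
  have "\<exists>i. u m i \<in> cl (B \<union> u m ` {..<i})"
  proof (rule ccontr)
    assume "\<not> ?thesis"
    then have "indep (B \<union> u m ` {..<Suc d})" "card (B \<union> u m ` {..<Suc d}) = card B + Suc d"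
      using indep_extend[OF B(1,2), of "Suc d" "u m"] by blast+
    then show False using card_indep_le_d[OF order_refl fin _ uF[OF order_refl]] by simp
  qed
  then show ?mem unfolding height_def by (rule LeastI_ex)
  have ext: "indep (B \<union> u m ` {..<i}) \<and> card (B \<union> u m ` {..<i}) = card B + i"
    if "i \<le> height B m" for i
  proof (rule indep_extend[OF B(1,2)])
    fix k assume "k < i"
    then have "k < height B m" using that by simp
    then show "u m k \<notin> cl (B \<union> u m ` {..<k})" unfolding height_def by (rule not_less_Least)
  qed
  show ?ind ?card using ext[OF order_refl] by blast+
  show ?le
  proof (rule ccontr)
    assume "\<not> ?le"
    then have le: "Suc d \<le> height B m" by simp
    have "card (B \<union> u m ` {..<Suc d}) \<le> d"
      using ext[OF le] by (intro card_indep_le_d[OF order_refl fin _ uF[OF order_refl]]) blast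
    then show False using ext[OF le] by simp
  qed
qed

lemma height_antimono:
  assumes "finite B" "indep B" "B \<subseteq> F_deg r d" "m < r" "B \<subseteq> B'"
  shows "height B' m \<le> height B m"
proof -
  have "B \<union> u m ` {..<height B m} \<subseteq> B' \<union> u m ` {..<height B m}" using assms(5) by blast
  then have "u m (height B m) \<in> cl (B' \<union> u m ` {..<height B m})"
    using subsetD[OF cl_mono height(1)[OF assms(1-4)]] by blast
  then show ?thesis unfolding height_def[of B'] by (rule Least_le)
qed

abbreviation stairs :: "nat set \<Rightarrow> (nat \<Rightarrow> nat) \<Rightarrow> 'a fvec set" where
  "stairs L \<iota> \<equiv> case_prod u ` (SIGMA m:L. {..<\<iota> m})"

text \<open>
  The columns \<open>u m 0, u m 1, \<dots>\<close> with \<open>m \<in> L\<close>, cut off at height \<open>\<iota> m\<close>, are jointly independent and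
  already span the full columns. The condition on the cardinality says that no two of the
  entries coincide.
\<close>
definition filled :: "nat set \<Rightarrow> (nat \<Rightarrow> nat) \<Rightarrow> bool" where
  "filled L \<iota> \<longleftrightarrow> L \<subseteq> {..<r} \<and> indep (stairs L \<iota>) \<and> card (stairs L \<iota>) = sum \<iota> L \<and>
     (\<forall>m\<in>L. \<iota> m \<le> d \<and> (\<forall>j\<le>d. u m j \<in> cl (stairs L \<iota>)))"

lemma filledD:
  assumes "filled L \<iota>"
  shows "finite L" "finite (stairs L \<iota>)" "indep (stairs L \<iota>)" "stairs L \<iota> \<subseteq> F_deg r d"
proof -
  show L: "finite L" using assms finite_subset unfolding filled_def by blast
  then show "finite (stairs L \<iota>)" by simp
  show "indep (stairs L \<iota>)" using assms by (simp add: filled_def)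
  show "stairs L \<iota> \<subseteq> F_deg r d"
  proof
    fix x assume "x \<in> stairs L \<iota>"
    then obtain m j where "m \<in> L" "j < \<iota> m" "x = u m j" by auto
    then show "x \<in> F_deg r d" using assms by (auto simp: filled_def intro!: u_F_deg)
  qed
qed

lemma stairs_insert:
  assumes "m \<notin> L"
  shows "stairs (insert m L) (\<iota>(m := i)) = stairs L \<iota> \<union> u m ` {..<i}"
  using assms by (auto simp: image_iff split: if_splits)+

text \<open>
  By the choice of the height, \<open>u m i\<close> is in the span. Shifting this relation repeatedly shows that
  the remaining entries of the column \<open>m\<close> are too: a shifted entry either still belongs to the
  stairs, or is the first one above them, which is in the span.
\<close>
lemma filled_insert:
  assumes fl: "filled L \<iota>" and m: "m < r" "m \<notin> L"
  defines "i \<equiv> height (stairs L \<iota>) m"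
  shows "filled (insert m L) (\<iota>(m := i))"
proof -
  note h = height[OF filledD(2-4)[OF fl] m(1), folded i_def]
  have st: "stairs (insert m L) (\<iota>(m := i)) = stairs L \<iota> \<union> u m ` {..<i}" (is "?S' = _")
    by (rule stairs_insert[OF m(2)])
  have L: "L \<subseteq> {..<r}" "\<And>l. l \<in> L \<Longrightarrow> \<iota> l \<le> d"
    "\<And>l j. l \<in> L \<Longrightarrow> j \<le> d \<Longrightarrow> u l j \<in> cl (stairs L \<iota>)"
    using fl by (auto simp: filled_def)
  have old: "u l j \<in> cl ?S'" if "l \<in> L" "j \<le> d" for l j
    using subsetD[OF cl_mono L(3)[OF that], of ?S'] unfolding st by blast
  have step: "u m j \<in> cl ?S'" if "j \<le> i" for j
  proof (cases "j = i")
    case True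
    then show ?thesis using h(1) unfolding st by simp
  next
    case False
    then have "u m j \<in> ?S'" using that unfolding st by auto
    then show ?thesis by (rule subsetD[OF subset_cl])
  qed
  have I: "(SIGMA l:insert m L. {..<(\<iota>(m := i)) l}) \<subseteq> {..<r} \<times> {..<d}" (is "?I \<subseteq> _")
  proof
    fix x assume "x \<in> ?I"
    then obtain l j where x: "x = (l, j)" "l \<in> insert m L" "j < (\<iota>(m := i)) l" by auto
    then have "j < d" using L(2)[of l] h(4) by (auto split: if_splits)
    then show "x \<in> {..<r} \<times> {..<d}" using x L(1) m(1) by auto
  qed
  have shifted: "(\<lambda>(l, j). u l (Suc j)) ` ?I \<subseteq> cl ?S'"
  proof
    fix x assume "x \<in> (\<lambda>(l, j). u l (Suc j)) ` ?I"
    then obtain l j where x: "(l, j) \<in> ?I" "x = u l (Suc j)" by auto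
    then have "j < d" using I by auto
    then show "x \<in> cl ?S'" using x old[of l "Suc j"] step[of "Suc j"] by (cases "l = m") auto
  qed
  have new: "u m j \<in> cl ?S'" if "j \<le> d" for j
    using that
  proof (induction j)
    case 0
    show ?case by (rule step) simp
  next
    case (Suc j)
    then have "j < d" "u m j \<in> cl ?S'" by simp_all
    from shift[OF I m(1) this] show ?case by (rule subsetD[OF cl_least[OF shifted]])
  qed
  have "sum (\<iota>(m := i)) (insert m L) = i + sum \<iota> L"
    using m(2) filledD(1)[OF fl] by (auto intro!: sum.cong)
  then have "card ?S' = sum (\<iota>(m := i)) (insert m L)"
    unfolding st h(3) using fl by (simp add: filled_def)
  moreover have "indep ?S'" unfolding st by (rule h(2))
  ultimately show ?thesis
    unfolding filled_def using L(1,2) m(1) h(4) old new by (auto split: if_splits)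
qed

text \<open>
  The vector adjoined next is one of greatest height. Heights only drop when the stairs grow, so the last
  condition, that the remaining heights are bounded by the previous ones, is preserved; it gives the
  monotonicity.
\<close>
lemma greedy:
  "k \<le> r \<Longrightarrow> \<exists>\<sigma> \<iota>. inj_on \<sigma> {..<k} \<and> filled (\<sigma> ` {..<k}) \<iota> \<and>
     (\<forall>b<k. \<forall>a<b. \<iota> (\<sigma> b) \<le> \<iota> (\<sigma> a)) \<and>
     (\<forall>m<r. m \<notin> \<sigma> ` {..<k} \<longrightarrow> (\<forall>a<k. height (stairs (\<sigma> ` {..<k}) \<iota>) m \<le> \<iota> (\<sigma> a)))"
proof (induction k)
  case 0
  have "filled {} \<iota>" for \<iota> by (simp add: filled_def indep_def)
  then show ?case by simp
next
  case (Suc k)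
  then obtain \<sigma> \<iota> where IH: "inj_on \<sigma> {..<k}" "filled (\<sigma> ` {..<k}) \<iota>"
    "\<And>a b. b < k \<Longrightarrow> a < b \<Longrightarrow> \<iota> (\<sigma> b) \<le> \<iota> (\<sigma> a)"
    "\<And>m a. m < r \<Longrightarrow> m \<notin> \<sigma> ` {..<k} \<Longrightarrow> a < k \<Longrightarrow>
       height (stairs (\<sigma> ` {..<k}) \<iota>) m \<le> \<iota> (\<sigma> a)"
    by (auto simp: Suc_le_eq)
  let ?L = "\<sigma> ` {..<k}"
  let ?R = "{..<r} - ?L" and ?h = "height (stairs ?L \<iota>)"
  have "card ?L < card {..<r}" using Suc.prems card_image[OF IH(1)] by simp
  then have "\<not> {..<r} \<subseteq> ?L" using card_mono[of ?L "{..<r}"] by auto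
  then have "finite (?h ` ?R)" "?h ` ?R \<noteq> {}" by auto
  then have "Max (?h ` ?R) \<in> ?h ` ?R" by (rule Max_in)
  then obtain m where "Max (?h ` ?R) = ?h m" "m \<in> ?R" by (rule imageE)
  then have m: "m \<in> ?R" "?h m = Max (?h ` ?R)" by simp_all
  have max: "?h m' \<le> ?h m" if "m' \<in> ?R" for m' unfolding m(2) using that by (intro Max_ge) auto
  define \<sigma>' where "\<sigma>' = \<sigma>(k := m)"
  define \<iota>' where "\<iota>' = \<iota>(m := ?h m)"
  have im: "\<sigma>' ` {..<Suc k} = insert m ?L" by (auto simp: \<sigma>'_def lessThan_Suc)
  have \<iota>': "\<iota>' (\<sigma>' a) = \<iota> (\<sigma> a)" if "a < k" for a
    using m(1) that by (auto simp: \<iota>'_def \<sigma>'_def)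
  have \<iota>'k: "\<iota>' (\<sigma>' k) = ?h m" by (simp add: \<iota>'_def \<sigma>'_def)
  have fl: "filled (\<sigma>' ` {..<Suc k}) \<iota>'"
    unfolding im \<iota>'_def using m(1) by (intro filled_insert[OF IH(2)]) auto
  have "inj_on \<sigma>' {..<Suc k}"
    using IH(1) m(1) by (auto simp: \<sigma>'_def lessThan_Suc inj_on_def)
  moreover have "\<iota>' (\<sigma>' b) \<le> \<iota>' (\<sigma>' a)" if "b < Suc k" "a < b" for a b
  proof (cases "b = k")
    case True
    then show ?thesis using that IH(4)[of m a] m(1) \<iota>' \<iota>'k by simp
  next
    case False
    then show ?thesis using that IH(3)[of b a] \<iota>' by simp
  qed
  moreover have "height (stairs (\<sigma>' ` {..<Suc k}) \<iota>') m' \<le> \<iota>' (\<sigma>' a)"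
    if m': "m' < r" "m' \<notin> \<sigma>' ` {..<Suc k}" and a: "a < Suc k" for m' a
  proof -
    have "m' \<in> ?R" using m' unfolding im by auto
    have "stairs ?L \<iota> \<subseteq> stairs (\<sigma>' ` {..<Suc k}) \<iota>'"
      unfolding im \<iota>'_def using stairs_insert[of m ?L \<iota> "?h m"] m(1) by blast
    then have "height (stairs (\<sigma>' ` {..<Suc k}) \<iota>') m' \<le> ?h m'"
      by (rule height_antimono[OF filledD(2-4)[OF IH(2)] m'(1)])
    also have "\<dots> \<le> ?h m" using \<open>m' \<in> ?R\<close> by (rule max)
    also have "\<dots> \<le> \<iota>' (\<sigma>' a)"
    proof (cases "a = k")
      case True
      then show ?thesis using \<iota>'k by simp
    next
      case False
      then show ?thesis using a IH(4)[of m a] m(1) \<iota>' by simp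
    qed
    finally show ?thesis .
  qed
  ultimately show ?case using fl by blast
qed

lemma u_eq_coord_change:
  assumes "\<rho> permutes S"
  shows "coord_change e \<rho> (mon_elt d (m, j)) = u (inv_into UNIV \<rho> m) j"
  unfolding mon_elt_eq_vec_at coord_change_vec_at[OF assms]
  by (simp only: shear_mult shear_power shear_X shear_Y u_def)

lemma u_generates:
  assumes "A.subspace Z" "\<And>m j. m < r \<Longrightarrow> j \<le> d \<Longrightarrow> u m j \<in> Z"
  shows "F_deg r d \<subseteq> Z"
proof -
  have id: "id permutes {..<r}" by (rule permutes_id)
  let ?T = "coord_change e id"
  have "A.subspace {x. ?T x \<in> Z}"
  proof (rule A.subspaceI)
    show "0 \<in> {x. ?T x \<in> Z}" using A.subspace_0[OF assms(1)] by (simp only: mem_Collect_eq coord_change_0)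
    show "x + y \<in> {x. ?T x \<in> Z}" if "x \<in> {x. ?T x \<in> Z}" "y \<in> {x. ?T x \<in> Z}" for x y
      using that A.subspace_add[OF assms(1)] by (simp only: mem_Collect_eq coord_change_add)
    show "ascale c x \<in> {x. ?T x \<in> Z}" if "x \<in> {x. ?T x \<in> Z}" for c x
      using that A.subspace_scale[OF assms(1)] by (simp only: mem_Collect_eq coord_change_ascale)
  qed
  moreover have "mon_elt d (m, j) \<in> {x. ?T x \<in> Z}" if "m < r" "j \<le> d" for m j
    using assms(2)[OF that] u_eq_coord_change[OF id] by simp
  ultimately have "F_deg r d \<subseteq> {x. ?T x \<in> Z}" by (rule F_deg_generated)
  then have "?T ` F_deg r d \<subseteq> Z" by blast
  then show ?thesis unfolding coord_change_image_F_deg[OF id] .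
qed

text \<open>
  When all \<open>r\<close> vectors have been adjoined, the stairs are a basis of the fibre in degree \<open>d\<close>. The
  columns of height zero come last, and deleting them turns the heights into a partition of \<open>d\<close>.
\<close>
lemma staircase_basis:
  obtains \<sigma> ps f where "\<sigma> permutes {..<r}" "ps \<in> partitions r d" "f \<notin> \<mm>"
    "basis_over ascale f (F_deg r d) V (\<lambda>(l, j). u (\<sigma> l) j) (SIGMA l:{..<length ps}. {..<ps ! l})"
proof -
  obtain \<sigma>0 \<iota> where inj: "inj_on \<sigma>0 {..<r}" and fl: "filled (\<sigma>0 ` {..<r}) \<iota>"
    and mono: "\<And>a b. b < r \<Longrightarrow> a < b \<Longrightarrow> \<iota> (\<sigma>0 b) \<le> \<iota> (\<sigma>0 a)"
    using greedy[OF order_refl] by blast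
  define \<sigma> where "\<sigma> l = (if l < r then \<sigma>0 l else l)" for l
  have "\<sigma>0 ` {..<r} \<subseteq> {..<r}" using fl by (simp add: filled_def)
  then have im: "\<sigma>0 ` {..<r} = {..<r}"
    using inj by (intro card_subset_eq) (auto simp: card_image)
  then have "bij_betw \<sigma> {..<r} {..<r}"
    using inj by (auto simp: \<sigma>_def bij_betw_def inj_on_def)
  then have \<sigma>: "\<sigma> permutes {..<r}"
    by (rule bij_imp_permutes) (simp add: \<sigma>_def)
  define f where "f l = \<iota> (\<sigma> l)" for l
  have mono': "f b \<le> f a" if "a \<le> b" "b < r" for a b
    using mono[of b a] that by (cases "a = b") (auto simp: f_def \<sigma>_def)
  note fl = fl[unfolded im]
  have gen: "F_deg r d \<subseteq> cl (stairs {..<r} \<iota>)"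
    using fl by (intro u_generates[OF subspace_cl]) (auto simp: filled_def)
  have "card (stairs {..<r} \<iota>) = d"
    using card_indep_le_d[OF order_refl filledD(2-4)[OF fl]]
      d_le_card_generators[OF order_refl filledD(2)[OF fl] gen] by (rule antisym)
  then have "(\<Sum>m<r. \<iota> m) = d" using fl by (simp add: filled_def)
  then have sum: "(\<Sum>l<r. f l) = d"
    using sum.permute[OF \<sigma>, of \<iota>] by (simp add: f_def comp_def)
  define s where "s = card {l. l < r \<and> f l > 0}"
  have s: "{l. l < r \<and> f l > 0} = {..<s}"
  proof -
    let ?P = "{l. l < r \<and> f l > 0}"
    have down: "a \<in> ?P" if "b \<in> ?P" "a \<le> b" for a b
      using that mono'[of a b] by auto
    have "finite ?P" by simp
    have "?P \<subseteq> {..<s}"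
    proof
      fix b assume b: "b \<in> ?P"
      then have "{..b} \<subseteq> ?P" using down by auto
      then have "card {..b} \<le> s" unfolding s_def by (intro card_mono) auto
      then show "b \<in> {..<s}" by simp
    qed
    then show ?thesis by (intro card_subset_eq) (auto simp: s_def)
  qed
  have "s \<le> r" unfolding s_def using card_mono[of "{..<r}" "{l. l < r \<and> f l > 0}"] by auto
  define ps where "ps = map f [0..<s]"
  have I: "(SIGMA l:{..<length ps}. {..<ps ! l}) = (SIGMA l:{..<r}. {..<f l})" (is "?I = ?I'")
  proof
    show "?I \<subseteq> ?I'" using \<open>s \<le> r\<close> by (auto simp: ps_def)
    show "?I' \<subseteq> ?I"
    proof
      fix x assume "x \<in> ?I'"
      then obtain l j where x: "x = (l, j)" "l < r" "j < f l" by auto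
      then have "l \<in> {..<s}" unfolding s[symmetric] by auto
      then show "x \<in> ?I" using x by (simp add: ps_def)
    qed
  qed
  have "ps \<in> partitions r d"
    unfolding partitions_def
  proof (intro CollectI conjI)
    show "sorted_wrt (\<ge>) ps"
      unfolding ps_def sorted_wrt_map
      using mono' \<open>s \<le> r\<close> by (auto simp: sorted_wrt_iff_nth_less)
    show "\<forall>i\<in>set ps. 0 < i"
    proof
      fix i assume "i \<in> set ps"
      then obtain l where "l \<in> {..<s}" "i = f l" by (auto simp: ps_def)
      then show "0 < i" unfolding s[symmetric] by simp
    qed
    show "length ps \<le> r" using \<open>s \<le> r\<close> by (simp add: ps_def)
    have "sum_list ps = (\<Sum>l<s. f l)"
      by (simp add: ps_def interv_sum_list_conv_sum_set_nat atLeast0LessThan)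
    also have "\<dots> = (\<Sum>l<r. f l)"
    proof (rule sum.mono_neutral_left)
      show "\<forall>l\<in>{..<r} - {..<s}. f l = 0" unfolding s[symmetric] by auto
    qed (use \<open>s \<le> r\<close> in auto)
    finally show "sum_list ps = d" using sum by simp
  qed
  moreover obtain g b where F: "free_at d (F_deg r d) g b" using free_at_F_deg[OF order_refl] .
  have t: "(\<lambda>(l, j). u (\<sigma> l) j) ` ?I = stairs {..<r} \<iota>"
  proof -
    have "stairs {..<r} \<iota> = stairs (\<sigma> ` {..<r}) \<iota>" using permutes_image[OF \<sigma>] by simp
    also have "\<dots> = (\<lambda>(l, j). u (\<sigma> l) j) ` ?I'"
      by (force simp: f_def)
    finally show ?thesis unfolding I by simp
  qed
  have "card ?I = d" unfolding I using sum by simp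
  moreover have "finite ?I" by simp
  ultimately obtain f where "f \<notin> \<mm>" "basis_over ascale f (F_deg r d) V (\<lambda>(l, j). u (\<sigma> l) j) ?I"
    using free_at_lift[OF F, of ?I "\<lambda>(l, j). u (\<sigma> l) j"] gen filledD(4)[OF fl] unfolding t by blast
  then show ?thesis using that \<sigma> \<open>ps \<in> partitions r d\<close> by blast
qed

end

section \<open>The covering\<close>

text \<open>
  The monomials \<open>l\<^sup>d\<^sup>-\<^sup>j y\<^sup>j e\<^bsub>\<sigma> l\<^esub>\<close> of the staircase basis are the images of the monomials in \<open>x\<close>, \<open>y\<close>
  under a coordinate change \<open>T\<close>, so \<open>V\<close> is the translate by \<open>T\<close> of \<open>T\<^sup>-\<^sup>1 V\<close>.
\<close>
lemma (in quot_fibre) exists_translate: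
  fixes \<phi> :: "'k::alg_closed_field \<Rightarrow> 'a"
  assumes \<phi>: "comm_ring_hom \<phi>"
  shows "\<exists>f ps. \<exists>g\<in>GL 2. \<exists>h\<in>GL r. f \<notin> \<mm> \<and> ps \<in> partitions r d \<and>
    V \<in> translate \<phi> r g h (Q_open r d ps) f"
proof -
  obtain c where c: "\<forall>v\<in>F_deg r d. smul (linear_form (\<phi> c)) v \<in> W \<longrightarrow> v \<in> W"
    using exists_injective_linear_form[OF \<phi>] by blast
  interpret quot_fibre_form \<mm> r d V "\<phi> c"
    by unfold_locales (use c in blast)
  obtain \<sigma> ps f where \<sigma>: "\<sigma> permutes {..<r}" and part: "ps \<in> partitions r d" and f: "f \<notin> \<mm>"
    and B: "basis_over ascale f (F_deg r d) V (\<lambda>(l, j). u (\<sigma> l) j)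
      (SIGMA l:{..<length ps}. {..<ps ! l})"
    by (rule staircase_basis)
  let ?\<rho> = "inv_into UNIV \<sigma>"
  have \<rho>: "?\<rho> permutes {..<r}" by (rule permutes_inv[OF \<sigma>])
  have \<rho>\<sigma>: "inv_into UNIV ?\<rho> = \<sigma>" by (rule permutes_inv_inv[OF \<sigma>])
  let ?T = "coord_change (\<phi> c) ?\<rho>" and ?T' = "coord_change (- \<phi> c) \<sigma>"
  note inv = coord_change_inverse[OF \<rho>, of "\<phi> c", unfolded \<rho>\<sigma>]
  have "?T' ` V \<in> Quot_points r d" by (rule Quot_points_coord_change[OF \<sigma> V])
  moreover have "basis_over ascale f (F_deg r d) (?T' ` V) (mon_elt d)
      (SIGMA l:{..<length ps}. {..<ps ! l})"
  proof -
    have "?T' (u (\<sigma> l) j) = mon_elt d (l, j)" for l j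
      using u_eq_coord_change[OF \<rho>, unfolded \<rho>\<sigma>, of l j] inv(2) by metis
    then have "(\<lambda>i. ?T' ((\<lambda>(l, j). u (\<sigma> l) j) i)) = mon_elt d" by (auto simp: fun_eq_iff)
    then show ?thesis using basis_over_coord_change[OF \<sigma> subspace_V B, of "- \<phi> c"] by simp
  qed
  ultimately have Q: "?T' ` V \<in> Q_open r d ps f" by (simp add: Q_open_def)
  let ?g = "shear_mat c" and ?h = "permutation_mat r ?\<rho> :: 'k mat"
  have "?T' ` V \<subseteq> F_mod r"
    using coord_change_F_mod[OF \<sigma>] graded_submoduleD(1)[OF graded_V] by blast
  then have "gl_act \<phi> r ?g ?h ` ?T' ` V = ?T ` ?T' ` V"
    using coord_change_eq_gl_act[OF \<phi> \<rho>] by (intro image_cong) auto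
  also have "\<dots> = V" by (simp add: image_image inv)
  finally have eq: "gl_act \<phi> r ?g ?h ` ?T' ` V = V" .
  have "V \<in> translate \<phi> r ?g ?h (Q_open r d ps) f"
    unfolding translate_def by (rule image_eqI, rule eq[symmetric], rule Q)
  then show ?thesis
    using f part
    by (intro exI[of _ f] exI[of _ ps] bexI[OF _ shear_mat_GL[of c]]
        bexI[OF _ permutation_mat_GL[OF \<rho>]] conjI)
qed

theorem proposition3p4:
  fixes \<phi> :: "'k::alg_closed_field \<Rightarrow> 'a::comm_ring_1"
    and r d :: nat
  assumes "comm_ring_hom \<phi>"
    and "r \<ge> 2" and "d \<ge> 1"
  shows "(Quot_points r d :: 'a fvec set set) =
    open_union (Quot_points r d) {Q_star \<phi> r d is | is. is \<in> partitions r d} 1"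
proof
  show "open_union (Quot_points r d) {Q_star \<phi> r d is | is. is \<in> partitions r d} 1
      \<subseteq> (Quot_points r d :: 'a fvec set set)"
    by (auto simp: open_union_def)
next
  show "(Quot_points r d :: 'a fvec set set) \<subseteq>
      open_union (Quot_points r d) {Q_star \<phi> r d is | is. is \<in> partitions r d} 1"
  proof
    fix V :: "'a fvec set" assume V: "V \<in> Quot_points r d"
    define good where "good f \<longleftrightarrow> (\<exists>is\<in>partitions r d. V \<in> Q_star \<phi> r d is f)" for f
    \<comment> \<open>the ideal generated by the good elements\<close>
    define J where "J = {(\<Sum>g\<in>G. c g * g) | G c. finite G \<and> (\<forall>g\<in>G. good g)}"
    \<comment> \<open>no further localization is needed to lie in the union of translates\<close>
    have goodI: "good f"
      if "ps \<in> partitions r d" "g \<in> GL 2" "h \<in> GL r" "V \<in> translate \<phi> r g h (Q_open r d ps) f"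
      for ps g h f
    proof -
      have "V \<in> Q_star \<phi> r d ps f"
        unfolding Q_star_def open_union_def
      proof (intro CollectI conjI exI[of _ "{1}"] exI[of _ "\<lambda>_. 1"] exI[of _ 0] ballI)
        fix g' :: 'a assume "g' \<in> {1}"
        then show "\<exists>U\<in>{translate \<phi> r g h (Q_open r d ps) | g h. g \<in> GL 2 \<and> h \<in> GL r}. V \<in> U (f * g')"
          using that by auto
      qed (use V in auto)
      then show ?thesis using that(1) by (auto simp: good_def)
    qed
    have "is_ideal J"
      unfolding is_ideal_def
    proof (intro conjI ballI allI)
      show "0 \<in> J" unfolding J_def by (intro CollectI exI[of _ "{}"]) simp
    next
      fix a b assume "a \<in> J" "b \<in> J"
      then obtain G c H e where a: "a = (\<Sum>g\<in>G. c g * g)" "finite G" "\<forall>g\<in>G. good g"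
        and b: "b = (\<Sum>g\<in>H. e g * g)" "finite H" "\<forall>g\<in>H. good g"
        unfolding J_def by blast
      let ?c = "\<lambda>g. (if g \<in> G then c g else 0) + (if g \<in> H then e g else 0)"
      have "(\<Sum>g\<in>G. c g * g) = (\<Sum>g\<in>G \<union> H. (if g \<in> G then c g else 0) * g)"
        using a(2) b(2) by (intro sum.mono_neutral_cong_left) auto
      moreover have "(\<Sum>g\<in>H. e g * g) = (\<Sum>g\<in>G \<union> H. (if g \<in> H then e g else 0) * g)"
        using a(2) b(2) by (intro sum.mono_neutral_cong_left) auto
      ultimately have "a + b = (\<Sum>g\<in>G \<union> H. ?c g * g)"
        by (simp only: a b sum.distrib distrib_right)
      then show "a + b \<in> J"
        unfolding J_def using a b by (intro CollectI exI[of _ "G \<union> H"] exI[of _ ?c]) auto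
    next
      fix a c assume "a \<in> J"
      then obtain G k where a: "a = (\<Sum>g\<in>G. k g * g)" "finite G" "\<forall>g\<in>G. good g"
        unfolding J_def by blast
      then have "c * a = (\<Sum>g\<in>G. (c * k g) * g)" by (simp add: sum_distrib_left mult.assoc)
      then show "c * a \<in> J" unfolding J_def using a by (intro CollectI exI[of _ G]) auto
    qed
    have "1 \<in> J"
    proof (rule ccontr)
      assume "1 \<notin> J"
      then obtain \<mm> where \<mm>: "J \<subseteq> \<mm>" "maximal_ideal \<mm>"
        using maximal_ideal_exists \<open>is_ideal J\<close> by blast
      interpret maximal_ideal \<mm> by (rule \<mm>(2))
      interpret quot_fibre \<mm> r d V by unfold_locales (rule V)
      obtain f ps g h where f: "f \<notin> \<mm>" and t: "ps \<in> partitions r d" "g \<in> GL 2" "h \<in> GL r"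
          "V \<in> translate \<phi> r g h (Q_open r d ps) f"
        using exists_translate[OF assms(1)] by (elim exE bexE conjE)
      have "good f" by (rule goodI[OF t])
      have "f \<in> J"
        unfolding J_def using \<open>good f\<close> by (intro CollectI exI[of _ "{f}"] exI[of _ "\<lambda>_. 1"]) simp
      then show False using f \<mm>(1) by blast
    qed
    then obtain G c where G: "1 = (\<Sum>g\<in>G. c g * g)" "finite G" "\<forall>g\<in>G. good g"
      unfolding J_def by blast
    show "V \<in> open_union (Quot_points r d) {Q_star \<phi> r d is | is. is \<in> partitions r d} 1"
      unfolding open_union_def
    proof (intro CollectI conjI V exI[of _ G] exI[of _ c] exI[of _ 0] ballI)
      fix g assume "g \<in> G"
      then obtain ps where "ps \<in> partitions r d" "V \<in> Q_star \<phi> r d ps g"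
        using G(3) unfolding good_def by blast
      then show "\<exists>U\<in>{Q_star \<phi> r d is | is. is \<in> partitions r d}. V \<in> U (1 * g)"
        by (intro bexI[of _ "Q_star \<phi> r d ps"]) auto
    qed (use G in auto)
  qed
qed

end
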